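(* Let $r^m_n=r^m_n(u)$, $(n,m)\in\mathbb{Z}^2$, be the octahedral functions, and $p_{\rm v},p_{\rm e},p_{\rm f}$ the polynomials in $u$, defined in the context. For all $(n,m)\in\mathbb{Z}^2$ the following three-term recurrences hold (as identities between rational functions of $u$): $$(4m-3)(4m+1)\,r^{m+1}_n-(4m-3)(4m+1)\,p_{\rm e}\,r^m_n-3(12m-12n-7)(12m+12n+1)\,p_{\rm v}\,r^{m-1}_n=0,$$ $$(12n-12m+7)\,r^m_{n+1}-8(3n+1)\,p_{\rm e}\,r^m_n+(12n+12m+1)\,p_{\rm f}^3\,r^m_{n-1}=0,$$ and the diagonal recurrences $$3(4m-3)(4m+1)\,r^{m+1}_{n+1}-(4m-3)\left[(12m+12n+7)p_{\rm f}^3-4(3n+1)p_{\rm e}^2\right]r^m_n+9(12m+12n+1)(12m+12n-11)\,p_{\rm v}\,p_{\rm f}^3\,r^{m-1}_{n-1}=0,$$ $$3(4m-3)(4m+1)\,p_{\rm f}^3\,r^{m+1}_{n-1}-(4m-3)\left[(12m-12n-1)p_{\rm f}^3+4(3n+1)p_{\rm e}^2\right]r^m_n+9(12m-12n-7)(12m-12n-19)\,p_{\rm v}\,r^{m-1}_{n+1}=0.$$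
   Context: ${}_2F_1$ is the Gauss hypergeometric function. Let $p_{\rm v}(u)=u(1-u)^4$, $p_{\rm e}(u)=(1+u)(1-34u+u^2)$, $p_{\rm f}(u)=1+14u+u^2$, which satisfy $p_{\rm e}^2-p_{\rm f}^3+108\,p_{\rm v}=0$, and let $$R(u)=-108\,\frac{p_{\rm v}(u)}{p_{\rm e}(u)^2}=1-\frac{p_{\rm f}(u)^3}{p_{\rm e}(u)^2}.$$ For $(n,m)\in\mathbb{Z}^2$, the octahedral function $r^m_n$ is defined implicitly, on a neighborhood of $u=0$ (with powers of $p_{\rm e}(u)$ equal to $1$ at $u=0$), by $${}_2F_1\!\left(-\tfrac1{24}-\tfrac m2-\tfrac n2,\ \tfrac{11}{24}-\tfrac m2-\tfrac n2;\ \tfrac34-m;\ R(u)\right)=p_{\rm e}(u)^{-1/12-m-n}\,r^m_n(u).$$ It is a rational function of $u$, with $r^m_n(0)=1$. *)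

theory Defs
  imports "HOL-Analysis.Analysis" "HOL-Computational_Algebra.Computational_Algebra"
begin

definition hyp2F1 :: "complex \<Rightarrow> complex \<Rightarrow> complex \<Rightarrow> complex \<Rightarrow> complex" where
  "hyp2F1 a b c z = eval_fps (fps_hypergeo [a, b] [c] 1) z"

definition p_v :: "complex poly" where
  "p_v = [:0, 1:] * [:1, -1:] ^ 4"

definition p_e :: "complex poly" where
  "p_e = [:1, 1:] * [:1, -34, 1:]"

definition p_f :: "complex poly" where
  "p_f = [:1, 14, 1:]"

definition oct_R :: "complex \<Rightarrow> complex" where
  "oct_R u = - 108 * poly p_v u / poly p_e u ^ 2"

type_synonym ratfun = "complex poly fract"

text \<open>
  \<open>is_octahedral m n f\<close>: the rational function \<open>f\<close> is regular at \<open>0\<close> and satisfies the defining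
  equation of the octahedral function with upper index \<open>m\<close> and lower index \<open>n\<close> near \<open>0\<close>.
  Since \<open>p_e\<close> has value \<open>1\<close> at \<open>0\<close>, the principal branch used by \<open>powr\<close> is, near \<open>0\<close>, the
  branch with value \<open>1\<close> there. The third hypergeometric parameter is never an integer, and
  \<open>oct_R 0 = 0\<close>, so the hypergeometric series converges near \<open>u = 0\<close>.
\<close>

definition is_octahedral :: "int \<Rightarrow> int \<Rightarrow> ratfun \<Rightarrow> bool" where
  "is_octahedral m n f \<longleftrightarrow>
     (\<exists>P Q. poly Q 0 \<noteq> 0 \<and> f = Fraction_Field.Fract P Q \<and>
        (\<forall>\<^sub>F u in nhds 0.
           hyp2F1 (- 1/24 - of_int m / 2 - of_int n / 2)
                  (11/24 - of_int m / 2 - of_int n / 2)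
                  (3/4 - of_int m) (oct_R u)
           = poly p_e u powr (- 1/12 - of_int m - of_int n) * (poly P u / poly Q u)))"

lemma is_octahedral_unique:
  assumes "is_octahedral m n f" "is_octahedral m n g"
  shows "f = g"
proof -
  define H where "H = (\<lambda>u. hyp2F1 (- 1/24 - of_int m / 2 - of_int n / 2)
    (11/24 - of_int m / 2 - of_int n / 2) (3/4 - of_int m) (oct_R u))"
  define E where "E = (\<lambda>u. poly p_e u powr (- 1/12 - of_int m - of_int n))"
  obtain P Q where Q: "poly Q 0 \<noteq> 0" and f: "f = Fraction_Field.Fract P Q"
    and 1: "\<forall>\<^sub>F u in nhds 0. H u = E u * (poly P u / poly Q u)"
    using assms(1) unfolding is_octahedral_def H_def E_def by blast
  obtain P' Q' where Q': "poly Q' 0 \<noteq> 0" and g: "g = Fraction_Field.Fract P' Q'"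
    and 2: "\<forall>\<^sub>F u in nhds 0. H u = E u * (poly P' u / poly Q' u)"
    using assms(2) unfolding is_octahedral_def H_def E_def by blast
  have nz: "\<forall>\<^sub>F u in nhds 0. poly p u \<noteq> 0" if "poly p 0 \<noteq> 0" for p :: "complex poly"
  proof -
    have "isCont (poly p) 0" by simp
    then have "(poly p \<longlongrightarrow> poly p 0) (nhds 0)"
      by (simp add: isCont_def tendsto_at_iff_tendsto_nhds)
    then show ?thesis using that by (rule tendsto_imp_eventually_ne)
  qed
  have pe0: "poly p_e 0 \<noteq> 0" by (simp add: p_e_def)
  have "\<forall>\<^sub>F u in nhds 0. poly (P * Q' - P' * Q) u = 0"
    using 1 2 nz[OF Q] nz[OF Q'] nz[OF pe0]
    by eventually_elim (simp add: E_def field_simps)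
  then have "\<forall>\<^sub>F u in at 0. poly (P * Q' - P' * Q) u = 0"
    by (simp add: eventually_nhds_conv_at)
  then have "\<exists>\<^sub>F u in at 0. poly (P * Q' - P' * Q) u = 0"
    by (intro eventually_frequently) auto
  then have "0 islimpt {u. poly (P * Q' - P' * Q) u = 0}"
    by (simp add: islimpt_conv_frequently_at)
  then have "infinite {u. poly (P * Q' - P' * Q) u = 0}"
    using islimpt_finite by blast
  then have "P * Q' - P' * Q = 0"
    using poly_roots_finite by blast
  moreover have "Q \<noteq> 0" "Q' \<noteq> 0" using Q Q' by auto
  ultimately show ?thesis unfolding f g by (simp add: eq_fract)
qed

text \<open>\<open>oct_r m n\<close> is the octahedral function with upper index \<open>m\<close> and lower index \<open>n\<close>.\<close>

definition oct_r :: "int \<Rightarrow> int \<Rightarrow> ratfun" where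
  "oct_r m n = (THE f. is_octahedral m n f)"

end

theory Submission
  imports Defs "HOL-Complex_Analysis.Laurent_Convergence"
begin

text \<open>
  Up to exchanging the two upper parameters, which differ by $1/2$, the index shifts of $(m,n)$ are
  integer shifts of the hypergeometric parameters, and because $R\,p_e^2 = -108\,p_v$ and
  $(1-R)\,p_e^2 = p_f^3$ the four recurrences are Gauss contiguous relations. All of them follow by
  expressing each contiguous function through $F$ and $F'$. The same formulas show that rationality of
  $r^m_n$ propagates to the neighbours, because $F'(R(u))$ is obtained from $F(R(u))$ by differentiation
  in $u$. It therefore suffices that $r^0_0 = 1$: both $F(R(u))$ for $(m,n)=(0,0)$ and $p_e^{-1/12}$ solve
  the pulled-back hypergeometric equation, whose local exponents at $u=0$ are $0$ and $1/4$, so that a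
  power series solution is determined by its constant term.
\<close>

text \<open>At (0,0) the hypergeometric equation has exponent differences 1/4, 1/3, 1/2 at 0, 1,
  infinity. The map R has ramification 4 above 0 (at u = 1), 3 above 1 (at the roots of p_f) and 2
  above infinity (at the roots of p_e), so after pullback only u = 0 and u = infinity remain
  singular in an essential way. The power -1/12 is twice the exponent a = -1/24 at infinity, because
  R has double poles at the roots of p_e.

  A three-term recurrence would propagate rationality only from two known neighbours; formulas in F
  and F' need a single starting value. Rationality cannot be bypassed, since \<open>oct_r\<close> is
  a definite description and carries information only after existence is known.

  Everything algebraic takes place among formal power series, with denominators cleared, so that
  each step is an identity in a commutative ring.\<close>

subsection \<open>Contiguous relations as first-order differential formulas\<close>

unbundle no vec_syntax

abbreviation F21 :: "complex \<Rightarrow> complex \<Rightarrow> complex \<Rightarrow> complex fps" where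
  "F21 a b c \<equiv> fps_hypergeo [a, b] [c] 1"

lemma F21_commute: "F21 a b c = F21 b a c"
  by (simp add: fps_eq_iff mult.commute)

text \<open>All integers are excluded, not only the nonpositive ones, because c = 3/4 - m is shifted
  in both directions and c + n, c - 1 and c - 1 + n all occur as divisors.\<close>

lemma not_Ints_shift:
  fixes c :: complex
  assumes "c \<notin> \<int>"
  shows "c \<noteq> 0" "c \<noteq> 1" "c + 1 \<notin> \<int>" "c + of_nat n \<noteq> 0" "c - 1 + of_nat n \<noteq> 0"
    "pochhammer c n \<noteq> 0"
proof -
  have *: "c \<noteq> of_int k" for k using assms by auto
  show "c \<noteq> 0" "c \<noteq> 1" using *[of 0] *[of 1] by auto
  show "c + of_nat n \<noteq> 0" using *[of "- int n"] by (auto simp: add_eq_0_iff2)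
  show "c - 1 + of_nat n \<noteq> 0" using *[of "1 - int n"] by (auto simp: algebra_simps add_eq_0_iff2)
  have "c \<noteq> - of_nat k" for k using *[of "- int k"] by auto
  then show "pochhammer c n \<noteq> 0" by (auto simp: pochhammer_eq_0_iff)
  show "c + 1 \<notin> \<int>" using assms
    by (metis Ints_1 Ints_diff add_diff_cancel)
qed

lemma pochhammer_plus1:
  fixes x :: complex shows "x * pochhammer (x + 1) n = pochhammer x n * (x + of_nat n)"
  by (metis pochhammer_rec pochhammer_Suc)

lemma pochhammer_minus1_Suc:
  fixes x :: complex shows "pochhammer (x - 1) (Suc n) = (x - 1) * pochhammer x n"
  by (simp add: pochhammer_rec)

lemma pochhammer_plus1_div:
  fixes x :: complex
  assumes "x \<noteq> 0" shows "pochhammer (x + 1) n = pochhammer x n * (x + of_nat n) / x"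
  using pochhammer_plus1[of x n] assms by (simp add: field_simps)

lemma pochhammer_minus1_div:
  fixes x :: complex
  assumes "x - 1 + of_nat n \<noteq> 0"
  shows "pochhammer (x - 1) n = (x - 1) * pochhammer x n / (x - 1 + of_nat n)"
  using pochhammer_plus1[of "x - 1" n] assms by (simp add: field_simps)

lemma F21_nth: "F21 a b c $ n = pochhammer a n * pochhammer b n / (pochhammer c n * fact n)"
  by simp

lemma F21_nth_Suc:
  "F21 a b c $ Suc n = F21 a b c $ n * ((a + of_nat n) * (b + of_nat n) / ((c + of_nat n) * of_nat (Suc n)))"
  by (simp only: F21_nth pochhammer_Suc fact_Suc of_nat_mult) (simp add: mult_ac)

lemma F21_nth_a_plus: "a * F21 (a + 1) b c $ n = (a + of_nat n) * F21 a b c $ n"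
  using pochhammer_plus1[of a n] unfolding F21_nth divide_inverse by algebra

lemma F21_nth_c_plus:
  assumes "c \<notin> \<int>"
  shows "F21 a b (c + 1) $ n = F21 a b c $ n * (c / (c + of_nat n))"
  by (simp only: F21_nth pochhammer_plus1_div[OF not_Ints_shift(1)[OF assms]]) (simp add: mult_ac)

lemma F21_nth_c_minus:
  assumes "c \<notin> \<int>"
  shows "F21 a b (c - 1) $ n = F21 a b c $ n * ((c - 1 + of_nat n) / (c - 1))"
  by (simp only: F21_nth pochhammer_minus1_div[OF not_Ints_shift(5)[OF assms]]) (simp add: mult_ac)

lemma F21_nth_b_minus_Suc:
  "F21 a (b - 1) c $ Suc n = F21 a b c $ n * ((a + of_nat n) * (b - 1) / ((c + of_nat n) * of_nat (Suc n)))"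
  by (simp only: F21_nth pochhammer_Suc[of a] pochhammer_Suc[of c] pochhammer_minus1_Suc fact_Suc of_nat_mult)
     (simp add: mult_ac)

lemma F21_nth_ab_minus_Suc:
  "F21 (a - 1) (b - 1) c $ Suc n = F21 a b c $ n * ((a - 1) * (b - 1) / ((c + of_nat n) * of_nat (Suc n)))"
  by (simp only: F21_nth pochhammer_Suc[of c] pochhammer_minus1_Suc fact_Suc of_nat_mult)
     (simp add: mult_ac)

lemma fps_ext_0_Suc:
  fixes f g :: "'a::zero fps"
  assumes "f $ 0 = g $ 0" "\<And>n. f $ Suc n = g $ Suc n" shows "f = g"
  using assms by (metis fps_ext old.nat.exhaust)

text \<open>The Euler operator x d/dx multiplies the n-th coefficient by n, and a (a+1)_n = (a + n)
  (a)_n. The lowering of c below rests on the same operator with c - 1 in place of a.\<close>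

lemma F21_a_plus: "fps_const a * F21 (a + 1) b c = fps_X * fps_deriv (F21 a b c) + fps_const a * F21 a b c"
proof (rule fps_ext_0_Suc, goal_cases)
  case (2 n)
  then show ?case
    by (simp add: F21_nth_a_plus ring_distribs del: fps_hypergeo_nth of_nat_Suc)
qed simp

lemma F21_c_minus:
  assumes "c \<notin> \<int>"
  shows "fps_const (c - 1) * F21 a b (c - 1) = fps_X * fps_deriv (F21 a b c) + fps_const (c - 1) * F21 a b c"
proof (rule fps_ext_0_Suc, goal_cases)
  case (2 n)
  then show ?case using not_Ints_shift(2)[OF assms]
    by (simp add: F21_nth_c_minus[OF assms] divide_simps ring_distribs del: fps_hypergeo_nth of_nat_Suc)
qed simp

text \<open>In the coefficient comparisons the inverses of c + n and 1 + n are unknowns subject to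
  these two equations, which turns an identity of fractions into an ideal membership
  problem.\<close>

lemma add_of_nat_inverse:
  fixes c :: complex
  assumes "c + of_nat n \<noteq> 0"
  shows "(c + of_nat n) * inverse (c + of_nat n) = 1" "(1 + of_nat n) * inverse (1 + of_nat n) = (1::complex)"
  using assms by (auto simp: of_nat_Suc[symmetric] simp del: of_nat_Suc)

lemma fps_X_mult_Suc_nth: "(fps_X * (f :: complex fps)) $ Suc n = f $ n"
  by simp

text \<open>Comparing n-th coefficients leaves (a+n)(b+n) + (c-a-b-n)(c+n) = (c-a)(c-b), in which n
  has dropped out.\<close>

lemma F21_c_plus:
  assumes "c \<notin> \<int>"
  shows "fps_const ((c - a) * (c - b)) * F21 a b (c + 1) =
    fps_const c * ((1 - fps_X) * fps_deriv (F21 a b c) + fps_const (c - a - b) * F21 a b c)"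
proof (rule fps_ext)
  fix n
  \<comment> \<open>With x F' written as the Euler operator, its n-th coefficient is n times that of
    F, and no case distinction on n = 0 is needed.\<close>
  have e: "(1 - fps_X) * fps_deriv (F21 a b c) = fps_deriv (F21 a b c) - fps_XD (F21 a b c)"
    by (simp add: fps_XD_def algebra_simps)
  define t where "t = F21 a b c $ n"
  show "(fps_const ((c - a) * (c - b)) * F21 a b (c + 1)) $ n =
    (fps_const c * ((1 - fps_X) * fps_deriv (F21 a b c) + fps_const (c - a - b) * F21 a b c)) $ n"
    using add_of_nat_inverse[OF not_Ints_shift(4)[OF assms, of n]]
    unfolding e fps_mult_left_const_nth fps_add_nth fps_sub_nth fps_deriv_nth fps_XD_nth F21_nth_c_plus[OF assms]
       Suc_eq_plus1[symmetric] F21_nth_Suc[of a b c] t_def[symmetric] of_nat_Suc divide_inverse inverse_mult_distrib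
    by algebra
qed

text \<open>Coefficient n + 1 on both sides is a multiple of coefficient n of F, since (b-1)_{n+1} =
  (b-1)(b)_n; this avoids dividing by b - 1 + n. What remains is (n+1+c-b)(b+n) - (c+n)(n+1) =
  (b-1)(c-b).\<close>

lemma F21_b_minus:
  assumes "c \<notin> \<int>"
  shows "fps_const (c - b) * F21 a (b - 1) c =
    fps_X * (1 - fps_X) * fps_deriv (F21 a b c) + (fps_const (c - b) - fps_const a * fps_X) * F21 a b c"
proof (rule fps_ext_0_Suc, goal_cases)
  case (2 n)
  define t where "t = F21 a b c $ n"
  have e: "fps_X * (1 - fps_X) * fps_deriv (F21 a b c) + (fps_const (c - b) - fps_const a * fps_X) * F21 a b c
     = fps_XD (F21 a b c) + fps_const (c - b) * F21 a b c - fps_X * (fps_XD (F21 a b c) + fps_const a * F21 a b c)"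
    by (simp add: fps_XD_def algebra_simps)
  show ?case
    using add_of_nat_inverse[OF not_Ints_shift(4)[OF assms, of n]]
    unfolding e fps_mult_left_const_nth fps_add_nth fps_sub_nth fps_XD_nth fps_X_mult_Suc_nth F21_nth_b_minus_Suc
       F21_nth_Suc[of a b c] t_def[symmetric] of_nat_Suc divide_inverse inverse_mult_distrib
    by algebra
qed simp

lemma F21_ab_minus_c_minus:
  assumes "c \<notin> \<int>"
  shows "fps_const (c - 1) * F21 (a - 1) (b - 1) (c - 1) =
    fps_X * (1 - fps_X) * fps_deriv (F21 a b c) + (fps_const (c - 1) - fps_const (a + b - 1) * fps_X) * F21 a b c"
proof (rule fps_ext_0_Suc, goal_cases)
  case (2 n)
  define t where "t = F21 a b c $ n"
  have e: "fps_X * (1 - fps_X) * fps_deriv (F21 a b c) + (fps_const (c - 1) - fps_const (a + b - 1) * fps_X) * F21 a b c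
     = fps_XD (F21 a b c) + fps_const (c - 1) * F21 a b c - fps_X * (fps_XD (F21 a b c) + fps_const (a + b - 1) * F21 a b c)"
    by (simp add: fps_XD_def algebra_simps)
  have *: "(c - 1) * inverse (c - 1) = 1" using not_Ints_shift(2)[OF assms] by simp
  show ?case
    using add_of_nat_inverse[OF not_Ints_shift(4)[OF assms, of n]] *
    unfolding e fps_mult_left_const_nth fps_add_nth fps_sub_nth fps_XD_nth fps_X_mult_Suc_nth
      F21_nth_c_minus[OF assms] F21_nth_ab_minus_Suc
       F21_nth_Suc[of a b c] t_def[symmetric] of_nat_Suc divide_inverse inverse_mult_distrib
    by algebra
qed simp

lemma F21_b_minus_c_minus:
  assumes "c \<notin> \<int>"
  shows "fps_const (c - 1) * F21 a (b - 1) (c - 1) =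
    fps_X * (1 - fps_X) * fps_deriv (F21 a b c) + (fps_const (c - 1) - fps_const a * fps_X) * F21 a b c"
proof (rule fps_ext_0_Suc, goal_cases)
  case (2 n)
  define t where "t = F21 a b c $ n"
  have e: "fps_X * (1 - fps_X) * fps_deriv (F21 a b c) + (fps_const (c - 1) - fps_const a * fps_X) * F21 a b c
     = fps_XD (F21 a b c) + fps_const (c - 1) * F21 a b c - fps_X * (fps_XD (F21 a b c) + fps_const a * F21 a b c)"
    by (simp add: fps_XD_def algebra_simps)
  have *: "(c - 1) * inverse (c - 1) = 1" using not_Ints_shift(2)[OF assms] by simp
  show ?case
    using add_of_nat_inverse[OF not_Ints_shift(4)[OF assms, of n]] *
    unfolding e fps_mult_left_const_nth fps_add_nth fps_sub_nth fps_XD_nth fps_X_mult_Suc_nth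
      F21_nth_c_minus[OF assms] F21_nth_b_minus_Suc
       F21_nth_Suc[of a b c] t_def[symmetric] of_nat_Suc divide_inverse inverse_mult_distrib
    by algebra
qed simp

lemma F21_a_plus_c_plus:
  assumes "c \<notin> \<int>"
  shows "fps_const (a * (c - b)) * F21 (a + 1) b (c + 1) =
    fps_const c * (fps_const a * F21 a b c - (1 - fps_X) * fps_deriv (F21 a b c))"
proof (rule fps_ext)
  fix n
  have e: "(1 - fps_X) * fps_deriv (F21 a b c) = fps_deriv (F21 a b c) - fps_XD (F21 a b c)"
    by (simp add: fps_XD_def algebra_simps)
  define t where "t = F21 a b c $ n"
  show "(fps_const (a * (c - b)) * F21 (a + 1) b (c + 1)) $ n =
    (fps_const c * (fps_const a * F21 a b c - (1 - fps_X) * fps_deriv (F21 a b c))) $ n"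
    using add_of_nat_inverse[OF not_Ints_shift(4)[OF assms, of n]] F21_nth_a_plus[of a b c n]
    unfolding e fps_mult_left_const_nth fps_add_nth fps_sub_nth fps_deriv_nth fps_XD_nth F21_nth_c_plus[OF assms]
       Suc_eq_plus1[symmetric] F21_nth_Suc[of a b c] t_def[symmetric] of_nat_Suc divide_inverse inverse_mult_distrib
    by algebra
qed

lemma F21_deriv:
  assumes "c \<notin> \<int>"
  shows "fps_const c * fps_deriv (F21 a b c) = fps_const (a * b) * F21 (a + 1) (b + 1) (c + 1)"
proof (rule fps_ext)
  fix n
  have 1: "b * F21 (a + 1) (b + 1) c $ n = (b + of_nat n) * F21 (a + 1) b c $ n"
    using F21_nth_a_plus[of b "a + 1" c n] by (simp only: F21_commute)
  define t where "t = F21 a b c $ n"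
  show "(fps_const c * fps_deriv (F21 a b c)) $ n = (fps_const (a * b) * F21 (a + 1) (b + 1) (c + 1)) $ n"
    using add_of_nat_inverse[OF not_Ints_shift(4)[OF assms, of n]] 1 F21_nth_a_plus[of a b c n]
    unfolding F21_nth_c_plus[OF assms] fps_mult_left_const_nth fps_deriv_nth
       Suc_eq_plus1[symmetric] F21_nth_Suc[of a b c] t_def[symmetric] of_nat_Suc divide_inverse inverse_mult_distrib
    by algebra
qed

subsection \<open>Power series of rational functions and the covering map\<close>

text \<open>A relation instead of an expansion map: the product form needs no division of series,
  and a denominator nonzero at 0 makes X the Taylor series of f at 0. Compatibility with the ring
  operations then carries identities of series over to rational functions.\<close>

definition expansion_of :: "complex fps \<Rightarrow> ratfun \<Rightarrow> bool" where
  "expansion_of X f \<longleftrightarrow> (\<exists>P Q. poly Q 0 \<noteq> 0 \<and> f = Fraction_Field.Fract P Q \<and> X * fps_of_poly Q = fps_of_poly P)"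

lemma expansion_of_poly: "expansion_of (fps_of_poly p) (to_fract p)"
  unfolding expansion_of_def by (intro exI[of _ p] exI[of _ 1]) (simp add: to_fract_def)

lemma expansion_of_of_int: "expansion_of (of_int k) (of_int k)"
proof -
  have "to_fract (of_int k :: complex poly) = of_int k"
  proof -
    have "to_fract (of_nat j :: complex poly) = of_nat j" for j
      by (induction j) simp_all
    then show ?thesis by (cases k rule: int_diff_cases) simp
  qed
  moreover have "fps_of_poly (of_int k) = (of_int k :: complex fps)"
    by (simp add: of_int_poly fps_of_poly_const fps_of_int)
  ultimately show ?thesis
    using expansion_of_poly[of "of_int k"] by simp
qed

lemma expansion_of_add:
  assumes "expansion_of X f" "expansion_of Y g"
  shows "expansion_of (X + Y) (f + g)"
proof -
  obtain P Q P' Q' where *: "poly Q 0 \<noteq> 0" "f = Fraction_Field.Fract P Q" "X * fps_of_poly Q = fps_of_poly P"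
    "poly Q' 0 \<noteq> 0" "g = Fraction_Field.Fract P' Q'" "Y * fps_of_poly Q' = fps_of_poly P'"
    using assms unfolding expansion_of_def by blast
  then have "Q \<noteq> 0" "Q' \<noteq> 0" by auto
  with * have "f + g = Fraction_Field.Fract (P * Q' + P' * Q) (Q * Q')" by simp
  moreover have "(X + Y) * fps_of_poly (Q * Q') = fps_of_poly (P * Q' + P' * Q)"
    unfolding fps_of_poly_mult fps_of_poly_add *(3,6)[symmetric] by (simp add: algebra_simps)
  ultimately show ?thesis
    unfolding expansion_of_def using *(1,4) by (metis poly_mult mult_eq_0_iff)
qed

lemma expansion_of_mult:
  assumes "expansion_of X f" "expansion_of Y g"
  shows "expansion_of (X * Y) (f * g)"
proof -
  obtain P Q P' Q' where *: "poly Q 0 \<noteq> 0" "f = Fraction_Field.Fract P Q" "X * fps_of_poly Q = fps_of_poly P"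
    "poly Q' 0 \<noteq> 0" "g = Fraction_Field.Fract P' Q'" "Y * fps_of_poly Q' = fps_of_poly P'"
    using assms unfolding expansion_of_def by blast
  then have "f * g = Fraction_Field.Fract (P * P') (Q * Q')" by simp
  moreover have "(X * Y) * fps_of_poly (Q * Q') = fps_of_poly (P * P')"
    unfolding fps_of_poly_mult *(3,6)[symmetric] by (simp add: mult_ac)
  ultimately show ?thesis
    unfolding expansion_of_def using *(1,4) by (metis poly_mult mult_eq_0_iff)
qed

lemma expansion_of_power: "expansion_of X f \<Longrightarrow> expansion_of (X ^ k) (f ^ k)"
  using expansion_of_of_int[of 1] by (induction k) (auto intro: expansion_of_mult)

lemma expansion_of_diff:
  assumes "expansion_of X f" "expansion_of Y g"
  shows "expansion_of (X - Y) (f - g)"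
  using expansion_of_add[OF assms(1) expansion_of_mult[OF expansion_of_of_int[of "-1"] assms(2)]] by simp

lemma expansion_of_zero:
  assumes "expansion_of 0 f" shows "f = 0"
proof -
  obtain P Q where *: "f = Fraction_Field.Fract P Q" "0 = fps_of_poly P"
    using assms unfolding expansion_of_def by auto
  then have "P = 0" by (metis fps_of_poly_0 fps_of_poly_eq_iff)
  then show ?thesis using *(1) by (simp add: fract_collapse)
qed

text \<open>The factor S is invertible near 0 and can be moved into the denominator. This is how
  constants, powers of p_e and the numerator of R' are divided out later.\<close>

lemma expansion_of_cancel:
  assumes "expansion_of (X * fps_of_poly S) f" "poly S 0 \<noteq> 0"
  shows "\<exists>g. expansion_of X g"
proof -
  obtain P Q where *: "poly Q 0 \<noteq> 0" "X * fps_of_poly S * fps_of_poly Q = fps_of_poly P"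
    using assms(1) unfolding expansion_of_def by blast
  then show ?thesis using assms(2)
    unfolding expansion_of_def by (intro exI[of _ "Fraction_Field.Fract P (S * Q)"] exI[of _ P] exI[of _ "S * Q"])
      (simp add: fps_of_poly_mult mult.assoc)
qed

lemma expansion_of_deriv:
  assumes "expansion_of X f"
  shows "\<exists>g. expansion_of (fps_deriv X) g"
proof -
  obtain P Q where *: "poly Q 0 \<noteq> 0" "X * fps_of_poly Q = fps_of_poly P"
    using assms(1) unfolding expansion_of_def by blast
  have "fps_deriv X * fps_of_poly (Q * Q) = fps_of_poly (pderiv P * Q - pderiv Q * P)"
    unfolding fps_of_poly_mult fps_of_poly_diff fps_of_poly_pderiv *(2)[symmetric]
    by (simp add: algebra_simps)
  then show ?thesis
    unfolding expansion_of_def using *(1)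
    by (intro exI[of _ "Fraction_Field.Fract (pderiv P * Q - pderiv Q * P) (Q * Q)"] exI[of _ "pderiv P * Q - pderiv Q * P"] exI[of _ "Q * Q"]) simp
qed

section \<open>The polynomials and the covering map R as power series\<close>

abbreviation pe :: "complex fps" where "pe \<equiv> fps_of_poly p_e"
abbreviation pf :: "complex fps" where "pf \<equiv> fps_of_poly p_f"
abbreviation pv :: "complex fps" where "pv \<equiv> fps_of_poly p_v"
abbreviation x :: "complex fps" where "x \<equiv> fps_X"

lemma fps_numeral_deriv: "fps_deriv (numeral k :: complex fps) = 0"
  by (simp add: numeral_fps_const)

lemma fps_of_poly_p: "pe = (1 + x) * (1 - 34 * x + x ^ 2)" "pf = 1 + 14 * x + x ^ 2" "pv = x * (1 - x) ^ 4"
  unfolding p_e_def p_f_def p_v_def fps_of_poly_mult fps_of_poly_power fps_of_poly_pCons fps_of_poly_0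
    fps_const_neg[symmetric] numeral_fps_const[symmetric] fps_const_1_eq_1 fps_const_0_eq_0
  by algebra+

lemma deriv_p:
  "fps_deriv pe = -33 - 66 * x + 3 * x ^ 2" "fps_deriv pf = 14 + 2 * x" "fps_deriv pv = (1 - x)^3 * (1 - 5 * x)"
proof -
  have [simp]: "fps_deriv (x ^ 2) = 2 * x" by (simp add: power2_eq_square)
  have "fps_deriv pe = (1 - 34 * x + x ^ 2) + (1 + x) * (- 34 + 2 * x)"
    unfolding fps_of_poly_p by (simp add: fps_numeral_deriv)
  also have "\<dots> = -33 - 66 * x + 3 * x ^ 2" by algebra
  finally show "fps_deriv pe = -33 - 66 * x + 3 * x ^ 2" .
  show "fps_deriv pf = 14 + 2 * x"
    unfolding fps_of_poly_p by (simp add: fps_numeral_deriv)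
  have "fps_deriv ((1 - x) ^ 4) = - 4 * (1 - x) ^ 3"
    by (simp add: fps_deriv_power numeral_fps_const)
  then have "fps_deriv pv = (1 - x) ^ 4 + x * (- 4 * (1 - x) ^ 3)"
    unfolding fps_of_poly_p fps_deriv_mult by simp
  also have "\<dots> = (1 - x)^3 * (1 - 5 * x)" by algebra
  finally show "fps_deriv pv = (1 - x)^3 * (1 - 5 * x)" .
qed

lemma pe_0: "pe $ 0 = 1" unfolding fps_of_poly_p by simp

definition Rf :: "complex fps" where "Rf = - 108 * pv / pe ^ 2"

lemma Rf_pe: "Rf * pe ^ 2 = - 108 * pv"
proof -
  have "(pe ^ 2) $ 0 \<noteq> 0" using pe_0 by (simp add: fps_power_zeroth)
  then show ?thesis unfolding Rf_def fps_divide_unit[OF \<open>(pe ^ 2) $ 0 \<noteq> 0\<close>] mult.assoc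
    by (simp only: inverse_mult_eq_1[OF \<open>(pe ^ 2) $ 0 \<noteq> 0\<close>] mult_1_right)
qed

lemma Rf_pe': "(1 - Rf) * pe ^ 2 = pf ^ 3"
proof -
  have "(1 - Rf) * pe ^ 2 = pe ^ 2 + 108 * pv" using Rf_pe by (simp add: algebra_simps)
  also have "\<dots> = pf ^ 3" unfolding fps_of_poly_p by algebra
  finally show ?thesis .
qed

lemma Rf_0: "Rf $ 0 = 0"
proof -
  have "(Rf * pe ^ 2) $ 0 = 0" unfolding Rf_pe by (simp add: fps_of_poly_p)
  then show ?thesis using pe_0 by (simp add: fps_power_zeroth)
qed

text \<open>The factors display the ramification of R: order 4 at u = 1 and order 3 at the roots of
  p_f contribute (1-u)^3 p_f^2, and the double poles of R become triple poles of R'.\<close>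

lemma Rf_deriv: "fps_deriv Rf * pe ^ 3 = - 108 * (1 - x) ^ 3 * pf ^ 2"
proof -
  have "fps_deriv (Rf * pe ^ 2) = fps_deriv (- 108 * pv)" by (simp only: Rf_pe)
  then have "fps_deriv Rf * pe ^ 2 + 2 * Rf * pe * fps_deriv pe = - 108 * fps_deriv pv"
    by (simp add: fps_numeral_deriv power2_eq_square algebra_simps)
  then have "fps_deriv Rf * pe ^ 3 = - 108 * (fps_deriv pv * pe - 2 * pv * fps_deriv pe)"
    using Rf_pe by algebra
  also have "\<dots> = - 108 * (1 - x) ^ 3 * pf ^ 2"
    unfolding deriv_p unfolding fps_of_poly_p by algebra
  finally show ?thesis .
qed

section \<open>Complex powers of p_e, in the branch with value 1 at u = 0\<close>

definition pe_pow :: "complex \<Rightarrow> complex fps" where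
  "pe_pow s = fps_binomial s oo (pe - 1)"

lemma pe_minus_1_0: "(pe - 1) $ 0 = 0" unfolding fps_sub_nth pe_0 by simp

lemma X_compose_pe: "x oo (pe - 1) = pe - 1"
  using fps_X_fps_compose_startby0[OF pe_minus_1_0] .

lemma pe_pow_add: "pe_pow (s + t) = pe_pow s * pe_pow t"
  unfolding pe_pow_def fps_binomial_add_mult by (rule fps_compose_mult_distrib[OF pe_minus_1_0])

lemma pe_pow_1: "pe_pow 1 = pe"
  unfolding pe_pow_def fps_binomial_1 fps_compose_add_distrib
  by (simp add: X_compose_pe)

lemma pe_pow_zero: "pe_pow 0 = 1"
  unfolding pe_pow_def by simp

lemma pe_pow_0: "pe_pow s $ 0 = 1"
  unfolding pe_pow_def by simp

text \<open>The binomial series B satisfies (1 + x) B' = s B; the chain rule with inner series p_e -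
  1 gives the claim.\<close>

lemma pe_pow_deriv: "pe * fps_deriv (pe_pow s) = fps_const s * fps_deriv pe * pe_pow s"
proof -
  have 1: "(1 + x) * fps_deriv (fps_binomial s) = fps_const s * fps_binomial s"
    unfolding fps_binomial_deriv by (simp add: fps_divide_unit mult.left_commute[of "1 + x"] inverse_mult_eq_1')
  have "(1 + x) oo (pe - 1) = pe"
    by (simp add: fps_compose_add_distrib X_compose_pe)
  then have "pe * (fps_deriv (fps_binomial s) oo (pe - 1)) = ((1 + x) * fps_deriv (fps_binomial s)) oo (pe - 1)"
    by (simp add: fps_compose_mult_distrib[OF pe_minus_1_0])
  also have "\<dots> = fps_const s * pe_pow s"
    unfolding 1 by (simp add: fps_compose_mult_distrib[OF pe_minus_1_0] pe_pow_def)
  finally have 2: "pe * (fps_deriv (fps_binomial s) oo (pe - 1)) = fps_const s * pe_pow s" .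
  have "fps_deriv (pe_pow s) = (fps_deriv (fps_binomial s) oo (pe - 1)) * fps_deriv pe"
    unfolding pe_pow_def by (subst fps_compose_deriv[OF pe_minus_1_0]) simp
  then show ?thesis using 2 by algebra
qed

section \<open>From formal series to functions near u = 0\<close>

lemma poly_has_fps_expansion: "poly p has_fps_expansion fps_of_poly (p :: complex poly)"
proof (induction p)
  case (pCons a p)
  have "(\<lambda>u. a + u * poly p u) has_fps_expansion fps_const a + fps_X * fps_of_poly p"
    by (intro fps_expansion_intros pCons)
  then show ?case by (simp add: fps_of_poly_pCons algebra_simps)
qed (simp add: has_fps_expansion_0)

lemma pe_powr_has_fps_expansion: "(\<lambda>u. poly p_e u powr s) has_fps_expansion pe_pow s"
proof -
  have "((\<lambda>u. (1 + u) powr s) \<circ> (\<lambda>u. poly p_e u - 1)) has_fps_expansion pe_pow s"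
    unfolding pe_pow_def
    by (intro has_fps_expansion_compose fps_expansion_intros poly_has_fps_expansion pe_minus_1_0)
  then show ?thesis by (simp add: o_def)
qed

lemma oct_R_has_fps_expansion: "oct_R has_fps_expansion Rf"
proof -
  have "(\<lambda>u. - 108 * poly p_v u / poly p_e u ^ 2) has_fps_expansion Rf"
    unfolding Rf_def by (intro fps_expansion_intros poly_has_fps_expansion has_fps_expansion_divide')
      (use pe_0 in \<open>auto simp: fps_power_zeroth\<close>)
  then show ?thesis by (simp add: oct_R_def[abs_def])
qed

lemma add_nat_ratio_tendsto: "(\<lambda>n. (a + of_nat n) / (c + of_nat n)) \<longlonglongrightarrow> (1 :: complex)"
proof -
  have "(\<lambda>n. (a * inverse (of_nat n) + 1) / (c * inverse (of_nat n) + 1)) \<longlonglongrightarrow> (a * 0 + 1) / (c * 0 + 1)"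
    by (intro tendsto_intros lim_inverse_n) auto
  moreover have "\<forall>\<^sub>F n in sequentially. (a * inverse (of_nat n) + 1) / (c * inverse (of_nat n) + 1) = (a + of_nat n) / (c + of_nat n)"
    using eventually_gt_at_top[of "0::nat"] by eventually_elim (simp add: divide_simps)
  ultimately show ?thesis by (simp add: tendsto_cong)
qed

text \<open>The ratio of successive coefficients tends to 1, hence is eventually below 3/2 in norm;
  at the point 1/2 the ratio test then has the bound 3/4. A positive radius suffices because R
  vanishes at u = 0.\<close>

lemma F21_conv_radius: "fps_conv_radius (F21 a b c) > 0"
proof -
  have "(\<lambda>n. (a + of_nat n) / (c + of_nat n) * ((b + of_nat n) / (1 + of_nat n))) \<longlonglongrightarrow> 1 * 1"
    by (intro tendsto_mult add_nat_ratio_tendsto)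
  then have "(\<lambda>n. norm ((a + of_nat n) / (c + of_nat n) * ((b + of_nat n) / (1 + of_nat n)))) \<longlonglongrightarrow> norm (1 * 1 :: complex)"
    by (rule tendsto_norm)
  then have "\<forall>\<^sub>F n in sequentially. norm ((a + of_nat n) / (c + of_nat n) * ((b + of_nat n) / (1 + of_nat n))) < 3 / 2"
    by (rule order_tendstoD) simp
  then obtain N where N: "norm ((a + of_nat n) / (c + of_nat n) * ((b + of_nat n) / (1 + of_nat n))) < 3 / 2"
    if "n \<ge> N" for n by (auto simp: eventually_sequentially)
  have "summable (\<lambda>n. F21 a b c $ n * (1 / 2) ^ n)"
  proof (rule summable_ratio_test)
    fix n assume "n \<ge> N"
    define r where "r = (a + of_nat n) / (c + of_nat n) * ((b + of_nat n) / (1 + of_nat n))"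
    have eq: "F21 a b c $ Suc n * (1 / 2) ^ Suc n = r / 2 * (F21 a b c $ n * (1 / 2) ^ n)"
      unfolding F21_nth_Suc r_def by (simp del: fps_hypergeo_nth add: add_ac)
    show "norm (F21 a b c $ Suc n * (1 / 2) ^ Suc n) \<le> 3 / 4 * norm (F21 a b c $ n * (1 / 2) ^ n)"
      unfolding eq norm_mult[of "r / 2"] norm_divide[of r] using N[OF \<open>n \<ge> N\<close>]
      unfolding r_def[symmetric] by (intro mult_right_mono) auto
  qed simp
  then have "ereal (norm (1 / 2 :: complex)) \<le> fps_conv_radius (F21 a b c)"
    unfolding fps_conv_radius_def by (rule conv_radius_geI)
  then show ?thesis by (rule less_le_trans[rotated]) simp
qed

definition hyp :: "int \<Rightarrow> int \<Rightarrow> complex fps" where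
  "hyp m n = F21 (- 1/24 - of_int m / 2 - of_int n / 2) (11/24 - of_int m / 2 - of_int n / 2) (3/4 - of_int m)"

text \<open>The defining equation solved for r^m_n: the series that must be the expansion of the
  octahedral function once it is known to be rational.\<close>

definition rho :: "int \<Rightarrow> int \<Rightarrow> complex fps" where
  "rho m n = pe_pow (1/12 + of_int m + of_int n) * (hyp m n oo Rf)"

lemma c_not_Int: "3/4 - of_int m \<notin> (\<int> :: complex set)"
proof
  assume "3/4 - of_int m \<in> (\<int> :: complex set)"
  then obtain k where "3/4 - of_int m = (of_int k :: complex)" by (auto elim: Ints_cases)
  then have "of_int 3 = (of_int (4 * (m + k)) :: complex)" by (simp add: field_simps)
  then have "3 = 4 * (m + k)" unfolding of_int_eq_iff .
  then show False by presburger
qed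

text \<open>Both sides of the defining equation are analytic at 0 with the same power series, so
  they agree near 0. Convergence is used here only; the rest of the argument is formal.\<close>

lemma is_octahedral_if:
  assumes "expansion_of (rho m n) f"
  shows "is_octahedral m n f"
proof -
  let ?s = "1/12 + of_int m + of_int n :: complex"
  obtain P Q where *: "poly Q 0 \<noteq> 0" "f = Fraction_Field.Fract P Q" "rho m n * fps_of_poly Q = fps_of_poly P"
    using assms unfolding expansion_of_def by blast
  have Q0: "fps_of_poly Q $ 0 \<noteq> 0" using *(1) by (simp add: poly_0_coeff_0)
  have 1: "(\<lambda>u. poly p_e u powr (- ?s) * (poly P u / poly Q u)) has_fps_expansion
      pe_pow (- ?s) * (fps_of_poly P / fps_of_poly Q)"
    by (intro fps_expansion_intros pe_powr_has_fps_expansion has_fps_expansion_divide' poly_has_fps_expansion Q0)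
  have "(eval_fps (hyp m n) \<circ> oct_R) has_fps_expansion (hyp m n oo Rf)"
    unfolding hyp_def
    by (intro has_fps_expansion_compose eval_fps_has_fps_expansion oct_R_has_fps_expansion Rf_0 F21_conv_radius)
  moreover have "hyp m n oo Rf = pe_pow (- ?s) * (fps_of_poly P / fps_of_poly Q)"
  proof -
    have "pe_pow (- ?s) * rho m n = pe_pow (- ?s + ?s) * (hyp m n oo Rf)"
      unfolding pe_pow_add rho_def by (simp only: mult.assoc)
    moreover have "fps_of_poly P / fps_of_poly Q = rho m n"
      unfolding *(3)[symmetric] using Q0 by (simp add: fps_divide_unit mult.assoc inverse_mult_eq_1')
    ultimately show ?thesis by (simp add: pe_pow_zero)
  qed
  ultimately have "(eval_fps (hyp m n) \<circ> oct_R) has_fps_expansion pe_pow (- ?s) * (fps_of_poly P / fps_of_poly Q)"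
    by simp
  with 1 have "\<forall>\<^sub>F u in nhds 0. (eval_fps (hyp m n) \<circ> oct_R) u = poly p_e u powr (- ?s) * (poly P u / poly Q u)"
    unfolding has_fps_expansion_def by (auto elim: eventually_elim2)
  then show ?thesis unfolding is_octahedral_def hyp2F1_def using *(1,2)
    by (intro exI[of _ P] exI[of _ Q]) (simp add: hyp_def)
qed

lemma oct_r_eqI:
  assumes "expansion_of (rho m n) f"
  shows "oct_r m n = f"
  unfolding oct_r_def using is_octahedral_if[OF assms] is_octahedral_unique by blast

subsection \<open>The base case\<close>

text \<open>Differentiation raises all three parameters by 1, and the relation lowering all three
  leads back; the composite of these two first-order operators is the hypergeometric
  equation.\<close>

lemma F21_ode:
  assumes "c \<notin> \<int>"
  shows "fps_X * (1 - fps_X) * fps_deriv (fps_deriv (F21 a b c)) +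
    (fps_const c - fps_const (a + b + 1) * fps_X) * fps_deriv (F21 a b c) = fps_const (a * b) * F21 a b c"
proof -
  have c: "fps_const c \<noteq> 0" using not_Ints_shift(1)[OF assms] by simp
  have 1: "fps_const c * fps_deriv (F21 a b c) = fps_const (a * b) * F21 (a + 1) (b + 1) (c + 1)"
    by (rule F21_deriv[OF assms])
  then have "fps_deriv (fps_const c * fps_deriv (F21 a b c)) = fps_deriv (fps_const (a * b) * F21 (a + 1) (b + 1) (c + 1))"
    by simp
  then have 2: "fps_const c * fps_deriv (fps_deriv (F21 a b c)) = fps_const (a * b) * fps_deriv (F21 (a + 1) (b + 1) (c + 1))"
    by simp
  \<comment> \<open>The lowering relation is taken at (a+1, b+1; c+1), so that it returns to the
    original series.\<close>
  have 3: "fps_const c * F21 a b c =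
    fps_X * (1 - fps_X) * fps_deriv (F21 (a + 1) (b + 1) (c + 1)) +
    (fps_const c - fps_const (a + b + 1) * fps_X) * F21 (a + 1) (b + 1) (c + 1)"
    using F21_ab_minus_c_minus[OF not_Ints_shift(3)[OF assms], of "a + 1" "b + 1"] by (simp add: add_ac)
  have "fps_const c * (fps_X * (1 - fps_X) * fps_deriv (fps_deriv (F21 a b c)) +
    (fps_const c - fps_const (a + b + 1) * fps_X) * fps_deriv (F21 a b c)) = fps_const c * (fps_const (a * b) * F21 a b c)"
    using 1 2 3 by algebra
  then show ?thesis using c by simp
qed

lemma deriv_X_power_Suc: "fps_deriv (fps_X ^ Suc j :: complex fps) = of_nat (Suc j) * fps_X ^ j"
  unfolding fps_deriv_power by (simp add: fps_of_nat del: of_nat_Suc)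

text \<open>If W has lowest term z x^(j+1), the coefficient of x^j in the equation is (j+1)(j A(0) +
  B(0)) z, which the assumption makes nonzero. The assumption says that no positive integer is a
  root of the indicial polynomial.\<close>

lemma ode_solution_zero:
  fixes A B C W :: "complex fps"
  assumes ode: "fps_X * A * fps_deriv (fps_deriv W) + B * fps_deriv W + C * W = 0"
    and W0: "W $ 0 = 0" and AB: "\<And>j. of_nat j * A $ 0 + B $ 0 \<noteq> 0"
  shows "W = 0"
proof (rule ccontr)
  assume "W \<noteq> 0"
  have "subdegree W \<noteq> 0" using W0 \<open>W \<noteq> 0\<close> by (metis nth_subdegree_nonzero)
  then obtain j where j: "subdegree W = Suc j" by (cases "subdegree W") auto
  define Z where "Z = fps_shift (Suc j) W"
  have W: "W = fps_X ^ Suc j * Z" unfolding Z_def j[symmetric]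
    by (metis fps_shift_times_fps_X_power mult.commute order_refl subdegree_decompose)
  have Z0: "Z $ 0 \<noteq> 0" using \<open>W \<noteq> 0\<close> unfolding Z_def by (simp flip: j)
  \<comment> \<open>\<open>Z1\<close> is the cofactor of x^j in W'; its constant term is (j+1) times
    that of \<open>Z\<close>.\<close>
  define Z1 where "Z1 = of_nat (Suc j) * Z + fps_X * fps_deriv Z"
  have W': "fps_deriv W = fps_X ^ j * Z1"
    using deriv_X_power_Suc[of j] unfolding W Z1_def fps_deriv_mult by (simp only: power_Suc ring_distribs mult_ac add_ac)
  \<comment> \<open>The extra factor x avoids the exponent j - 1, which is meaningless for j =
    0.\<close>
  have "fps_X * fps_deriv (fps_X ^ j :: complex fps) = of_nat j * fps_X ^ j"
  proof (cases j)
    case (Suc i)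
    show ?thesis unfolding Suc deriv_X_power_Suc by (simp only: power_Suc mult_ac)
  qed simp
  then have W'': "fps_X * fps_deriv (fps_deriv W) = fps_X ^ j * (of_nat j * Z1 + fps_X * fps_deriv Z1)"
  proof -
    have "fps_X * fps_deriv (fps_deriv W) = fps_X ^ j * (fps_X * fps_deriv Z1) + (fps_X * fps_deriv (fps_X ^ j)) * Z1"
      unfolding W' fps_deriv_mult by (simp only: ring_distribs mult_ac)
    also have "\<dots> = fps_X ^ j * (of_nat j * Z1 + fps_X * fps_deriv Z1)"
      unfolding \<open>fps_X * fps_deriv (fps_X ^ j) = _\<close> by (simp only: ring_distribs mult_ac add_ac)
    finally show ?thesis .
  qed
  have "fps_X ^ j * (A * (of_nat j * Z1 + fps_X * fps_deriv Z1) + B * Z1 + fps_X * (C * Z))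
    = A * (fps_X * fps_deriv (fps_deriv W)) + B * fps_deriv W + C * W"
    by (subst W'', subst W', subst W) (simp only: power_Suc ring_distribs mult_ac add_ac)
  also have "\<dots> = 0" using ode by (simp only: mult_ac)
  finally have "fps_X ^ j * (A * (of_nat j * Z1 + fps_X * fps_deriv Z1) + B * Z1 + fps_X * (C * Z)) = 0" .
  then have "A * (of_nat j * Z1 + fps_X * fps_deriv Z1) + B * Z1 + fps_X * (C * Z) = 0"
    by simp
  then have "(A * (of_nat j * Z1 + fps_X * fps_deriv Z1) + B * Z1 + fps_X * (C * Z)) $ 0 = 0"
    by simp
  then have "(of_nat j * A $ 0 + B $ 0) * Z1 $ 0 = 0"
    by (simp add: algebra_simps flip: fps_of_nat)
  then have "Z1 $ 0 = 0" using AB by simp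
  then have "of_nat (Suc j) * Z $ 0 = 0" unfolding Z1_def by (simp del: of_nat_Suc flip: fps_of_nat)
  then show False using Z0 by (simp del: of_nat_Suc)
qed

text \<open>
  The hypergeometric equation with parameters $(-1/24, 11/24; 3/4)$, written in the variable $u$ and
  cleared of denominators; \<open>pullback_coeff\<close> is the coefficient of the first derivative.
\<close>

definition pullback_coeff :: "complex fps" where
  "pullback_coeff = pe * (16 * (3 * x * (1 - x) * pf * fps_deriv pe - x * pe * (2 * (1 - x) * fps_deriv pf - 3 * pf)) + 12 * pe ^ 2 + 2448 * pv)"

abbreviation pullback_ode :: "complex fps \<Rightarrow> bool" where
  "pullback_ode H \<equiv> x * (16 * (1 - x) * pf * pe ^ 2) * fps_deriv (fps_deriv H) + pullback_coeff * fps_deriv H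
     + (- 33 * (1 - x) ^ 3 * pf ^ 2) * H = 0"

lemma compose_Rf_deriv: "pe ^ 3 * fps_deriv (F oo Rf) = - 108 * (1 - x) ^ 3 * pf ^ 2 * (fps_deriv F oo Rf)"
  unfolding fps_compose_deriv[OF Rf_0] using Rf_deriv by algebra

lemma pe_nz: "pe \<noteq> 0" using pe_0 by auto
lemma pf_nz: "pf \<noteq> 0" by (metis fps_of_poly_0 fps_of_poly_eq_iff p_f_def pCons_eq_0_iff one_neq_zero)
lemma one_minus_X_nz: "1 - x \<noteq> 0"
  by (metis fps_nonzero_nth fps_sub_nth fps_one_nth fps_X_nth diff_zero one_neq_zero zero_neq_one)

text \<open>The chain rule, cleared to p_e^3 H' = -108 N H1 and p_e^3 H1' = -108 N H2, eliminates
  first \<open>H2\<close> and then \<open>H1\<close> from the composed equation. Surplus factors N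
  and p_e^2 are cancelled, which is allowed because series form an integral domain.\<close>

lemma F21_compose_Rf_ode:
  assumes "c = 3/4" "a = - 1/24" "b = 11/24"
  shows "pullback_ode (F21 a b c oo Rf)"
proof -
  have "3/4 \<notin> (\<int> :: complex set)" using c_not_Int[of 0] by simp
  define F where "F = F21 a b c"
  define H where "H = F oo Rf"
  define H1 where "H1 = fps_deriv F oo Rf"
  define H2 where "H2 = fps_deriv (fps_deriv F) oo Rf"
  define N where "N = (1 - x) ^ 3 * pf ^ 2"
  have i: "pe ^ 3 * fps_deriv H = - 108 * N * H1"
    unfolding H_def H1_def N_def using compose_Rf_deriv by (simp add: mult.assoc)
  have ii: "pe ^ 3 * fps_deriv H1 = - 108 * N * H2"
    unfolding H2_def H1_def N_def using compose_Rf_deriv by (simp add: mult.assoc)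
  have "fps_X * (1 - fps_X) * fps_deriv (fps_deriv F) + (fps_const (3/4) - fps_const (17/12) * fps_X) * fps_deriv F
    = fps_const (- 11 / 576) * F"
    using F21_ode[of "3/4" "- 1/24" "11/24"] \<open>3/4 \<notin> \<int>\<close> unfolding F_def assms by simp
  note E = this
  \<comment> \<open>576 is a common denominator of c = 3/4, a + b + 1 = 17/12 and ab =
    -11/576.\<close>
  define K :: "complex fps" where "K = fps_const 576"
  have K: "K = 576" "K * (fps_const (3/4) - fps_const (17/12) * fps_X) = 432 - 816 * fps_X" "K * fps_const (- 11 / 576) = - 11"
    by (simp_all add: K_def right_diff_distrib numeral_fps_const flip: mult.assoc)
  have "K * (fps_X * (1 - fps_X) * fps_deriv (fps_deriv F)) + (K * (fps_const (3/4) - fps_const (17/12) * fps_X)) * fps_deriv F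
    = K * (fps_X * (1 - fps_X) * fps_deriv (fps_deriv F) + (fps_const (3/4) - fps_const (17/12) * fps_X) * fps_deriv F)"
    by (simp only: distrib_left mult.assoc)
  also have "\<dots> = (K * fps_const (- 11 / 576)) * F"
    unfolding E by (simp only: mult.assoc)
  finally have "576 * (fps_X * (1 - fps_X) * fps_deriv (fps_deriv F)) + (432 - 816 * fps_X) * fps_deriv F
    = - 11 * F"
    unfolding K(2,3) unfolding K(1) .
  then have "(576 * (fps_X * (1 - fps_X) * fps_deriv (fps_deriv F)) + (432 - 816 * fps_X) * fps_deriv F) oo Rf
    = - 11 * F oo Rf" by simp
  then have "576 * (Rf * (1 - Rf) * H2) + (432 - 816 * Rf) * H1 = - 11 * H"
    unfolding H_def H1_def H2_def
    by (simp add: fps_compose_add_distrib fps_compose_sub_distrib fps_compose_mult_distrib[OF Rf_0] Rf_0 numeral_fps_const fps_const_compose)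
  then have iii: "- 62208 * pv * pf ^ 3 * H2 + pe ^ 2 * (432 * pe ^ 2 + 88128 * pv) * H1 + 11 * pe ^ 4 * H = 0"
  proof -
    have "576 * ((Rf * pe ^ 2) * ((1 - Rf) * pe ^ 2) * H2) + pe ^ 2 * (432 * pe ^ 2 - 816 * (Rf * pe ^ 2)) * H1 + 11 * pe ^ 4 * H
      = pe ^ 4 * (576 * (Rf * (1 - Rf) * H2) + (432 - 816 * Rf) * H1 - (- 11 * H))" by algebra
    also have "\<dots> = 0" unfolding \<open>576 * (Rf * (1 - Rf) * H2) + (432 - 816 * Rf) * H1 = - 11 * H\<close> by simp
    finally show ?thesis unfolding Rf_pe Rf_pe' by (simp add: algebra_simps)
  qed
  \<comment> \<open>This makes the coefficient of \<open>H2\<close> divisible by N, as needed to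
    replace N \<open>H2\<close> by the derivative of \<open>H1\<close>.\<close>
  have v: "pv * pf ^ 3 = x * (1 - x) * pf * N" unfolding N_def fps_of_poly_p(3) by algebra
  have "N * pe ^ 2 * (576 * x * (1 - x) * pf * pe * fps_deriv H1 + (432 * pe ^ 2 + 88128 * pv) * H1 + 11 * pe ^ 2 * H) = 0"
  proof -
    have "N * pe ^ 2 * (576 * x * (1 - x) * pf * pe * fps_deriv H1 + (432 * pe ^ 2 + 88128 * pv) * H1 + 11 * pe ^ 2 * H)
      = 576 * (x * (1 - x) * pf * N) * (pe ^ 3 * fps_deriv H1) + N * pe ^ 2 * (432 * pe ^ 2 + 88128 * pv) * H1 + 11 * N * pe ^ 4 * H"
      by algebra
    also have "\<dots> = N * (- 62208 * pv * pf ^ 3 * H2 + pe ^ 2 * (432 * pe ^ 2 + 88128 * pv) * H1 + 11 * pe ^ 4 * H)"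
      unfolding v[symmetric] ii by algebra
    finally show ?thesis unfolding iii by simp
  qed
  moreover have "N * pe ^ 2 \<noteq> 0" unfolding N_def using pe_nz pf_nz one_minus_X_nz by simp
  ultimately have iv: "576 * x * (1 - x) * pf * pe * fps_deriv H1 + (432 * pe ^ 2 + 88128 * pv) * H1 + 11 * pe ^ 2 * H = 0"
    by (metis mult_eq_0_iff)
  have "fps_deriv (pe ^ 3 * fps_deriv H) = fps_deriv (- 108 * N * H1)" unfolding i ..
  then have d: "3 * pe ^ 2 * fps_deriv pe * fps_deriv H + pe ^ 3 * fps_deriv (fps_deriv H) = - 108 * (fps_deriv N * H1 + N * fps_deriv H1)"
    by (simp add: fps_deriv_power fps_numeral_deriv algebra_simps eval_nat_numeral)
  have N': "(1 - x) * pf * fps_deriv N = N * (2 * (1 - x) * fps_deriv pf - 3 * pf)"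
    unfolding N_def by (simp add: fps_deriv_power fps_numeral_deriv algebra_simps eval_nat_numeral)
  have "36 * pe ^ 2 * (x * (16 * (1 - x) * pf * pe ^ 2) * fps_deriv (fps_deriv H) + pullback_coeff * fps_deriv H
     + (- 33 * N) * H) = - 108 * N * (576 * x * (1 - x) * pf * pe * fps_deriv H1 + (432 * pe ^ 2 + 88128 * pv) * H1 + 11 * pe ^ 2 * H)"
  proof -
    have 1: "x * (16 * (1 - x) * pf * pe ^ 2) * fps_deriv (fps_deriv H) * (36 * pe ^ 2) =
      576 * x * (1 - x) * pf * pe * (3 * pe ^ 2 * fps_deriv pe * fps_deriv H + pe ^ 3 * fps_deriv (fps_deriv H))
      - 1728 * x * (1 - x) * pf * fps_deriv pe * (pe ^ 3 * fps_deriv H)" by algebra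
    have 2: "pullback_coeff * fps_deriv H * (36 * pe ^ 2) = (pe ^ 3 * fps_deriv H) *
      (1728 * x * (1 - x) * pf * fps_deriv pe - 576 * x * pe * (2 * (1 - x) * fps_deriv pf - 3 * pf) + 432 * pe ^ 2 + 88128 * pv)"
      unfolding pullback_coeff_def by algebra
    have 3: "576 * x * (1 - x) * pf * pe * (- 108 * (fps_deriv N * H1 + N * fps_deriv H1))
      = - 62208 * x * pe * H1 * ((1 - x) * pf * fps_deriv N) - 62208 * x * (1 - x) * pf * pe * N * fps_deriv H1"
      by algebra
    have "36 * pe ^ 2 * (x * (16 * (1 - x) * pf * pe ^ 2) * fps_deriv (fps_deriv H) + pullback_coeff * fps_deriv H + (- 33 * N) * H)
      = x * (16 * (1 - x) * pf * pe ^ 2) * fps_deriv (fps_deriv H) * (36 * pe ^ 2)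
        + pullback_coeff * fps_deriv H * (36 * pe ^ 2) - 1188 * N * pe ^ 2 * H" by algebra
    also have "\<dots> = - 108 * N * (576 * x * (1 - x) * pf * pe * fps_deriv H1 + (432 * pe ^ 2 + 88128 * pv) * H1 + 11 * pe ^ 2 * H)"
      unfolding 1 2 d 3 N' i by algebra
    finally show ?thesis .
  qed
  also have "\<dots> = 0" unfolding iv by simp
  finally have "x * (16 * (1 - x) * pf * pe ^ 2) * fps_deriv (fps_deriv H) + pullback_coeff * fps_deriv H
     + (- 33 * N) * H = 0"
    using pe_nz by simp
  then show ?thesis unfolding H_def F_def N_def by (simp only: mult.assoc mult_minus_left)
qed

text \<open>Y = p_e^(-1/12) satisfies 12 p_e Y' = -p_e' Y. Differentiating once more makes Y'' a
  multiple of Y as well, and the differential equation reduces to one identity between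
  polynomials.\<close>

lemma pe_pow_ode: "pullback_ode (pe_pow (- 1 / 12))"
proof -
  define Y where "Y = pe_pow (- 1 / 12)"
  have "fps_const 12 * (pe * fps_deriv Y) = fps_const 12 * fps_const (- 1 / 12) * fps_deriv pe * Y"
    unfolding Y_def pe_pow_deriv by (simp add: mult.assoc)
  then have 1: "12 * pe * fps_deriv Y = - fps_deriv pe * Y"
    by (simp add: numeral_fps_const mult.assoc flip: fps_const_neg)
  then have "fps_deriv (12 * pe * fps_deriv Y) = fps_deriv (- fps_deriv pe * Y)" by simp
  then have 2: "12 * fps_deriv pe * fps_deriv Y + 12 * pe * fps_deriv (fps_deriv Y) =
    - fps_deriv (fps_deriv pe) * Y - fps_deriv pe * fps_deriv Y"
    by (simp add: fps_numeral_deriv algebra_simps)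
  have pe'': "fps_deriv (fps_deriv pe) = 6 * x - 66"
    unfolding deriv_p by (simp add: fps_numeral_deriv fps_deriv_power)
  have 3: "144 * pe ^ 2 * fps_deriv (fps_deriv Y) = (13 * fps_deriv pe ^ 2 - 12 * pe * fps_deriv (fps_deriv pe)) * Y"
    using 1 2 by algebra
  have poly_identity: "16 * x * (1 - x) * pf * (13 * fps_deriv pe ^ 2 - 12 * pe * fps_deriv (fps_deriv pe))
    - 12 * fps_deriv pe * (16 * (3 * x * (1 - x) * pf * fps_deriv pe - x * pe * (2 * (1 - x) * fps_deriv pf - 3 * pf)) + 12 * pe ^ 2 + 2448 * pv)
    - 4752 * (1 - x) ^ 3 * pf ^ 2 = 0"
    unfolding pe'' unfolding deriv_p unfolding fps_of_poly_p by algebra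
  then have "144 * (x * (16 * (1 - x) * pf * pe ^ 2) * fps_deriv (fps_deriv Y) + pullback_coeff * fps_deriv Y
     + (- 33 * (1 - x) ^ 3 * pf ^ 2) * Y) = 0"
  proof -
    let ?B = "16 * (3 * x * (1 - x) * pf * fps_deriv pe - x * pe * (2 * (1 - x) * fps_deriv pf - 3 * pf)) + 12 * pe ^ 2 + 2448 * pv"
    let ?E = "13 * fps_deriv pe ^ 2 - 12 * pe * fps_deriv (fps_deriv pe)"
    \<comment> \<open>The bracket of \<open>pullback_coeff\<close> is replaced by an arbitrary B,
      since only linearity in it matters; its actual value enters through
      \<open>poly_identity\<close>.\<close>
    have "144 * (x * (16 * (1 - x) * pf * pe ^ 2) * fps_deriv (fps_deriv Y) + (pe * B) * fps_deriv Y
      + (- 33 * (1 - x) ^ 3 * pf ^ 2) * Y)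
      = (16 * x * (1 - x) * pf * ?E - 12 * fps_deriv pe * B - 4752 * (1 - x) ^ 3 * pf ^ 2) * Y" for B
    proof -
      have "144 * (x * (16 * (1 - x) * pf * pe ^ 2) * fps_deriv (fps_deriv Y) + (pe * B) * fps_deriv Y
        + (- 33 * (1 - x) ^ 3 * pf ^ 2) * Y)
        = 16 * x * (1 - x) * pf * (144 * pe ^ 2 * fps_deriv (fps_deriv Y)) + 12 * B * (12 * pe * fps_deriv Y)
          - 4752 * (1 - x) ^ 3 * pf ^ 2 * Y" by algebra
      then show ?thesis unfolding 1 3 by algebra
    qed
    from this[of ?B] show ?thesis unfolding pullback_coeff_def poly_identity by simp
  qed
  then have "(144 :: complex fps) = 0 \<or> pullback_ode Y" by (simp only: mult_eq_0_iff[of 144])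
  then show ?thesis unfolding Y_def[symmetric] by simp
qed

lemma hyp_0_0: "hyp 0 0 oo Rf = pe_pow (- 1 / 12)"
proof -
  define W where "W = (hyp 0 0 oo Rf) - pe_pow (- 1 / 12)"
  have "pullback_ode (hyp 0 0 oo Rf)" unfolding hyp_def by (rule F21_compose_Rf_ode) auto
  then have "pullback_ode W" using pe_pow_ode unfolding W_def fps_deriv_sub by algebra
  moreover have "W $ 0 = 0" unfolding W_def by (simp add: pe_pow_0 hyp_def)
  \<comment> \<open>With A(0) = 16 and B(0) = 12 the indicial roots are 0 and 1 - 12/16 =
    1/4.\<close>
  moreover have "of_nat j * (16 * (1 - x) * pf * pe ^ 2) $ 0 + pullback_coeff $ 0 \<noteq> 0" for j
  proof -
    have 1: "(16 * (1 - x) * pf * pe ^ 2) $ 0 = 16" "pullback_coeff $ 0 = 12"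
      unfolding pullback_coeff_def fps_of_poly_p by (simp_all add: fps_power_zeroth)
    have "(of_nat (j * 16 + 12) :: complex) \<noteq> 0" unfolding of_nat_eq_0_iff by presburger
    then show ?thesis unfolding 1 by simp
  qed
  ultimately have "W = 0" by (rule ode_solution_zero)
  then show ?thesis unfolding W_def by simp
qed

lemma rho_0_0: "rho 0 0 = 1"
  unfolding rho_def hyp_0_0 pe_pow_add[symmetric] by (simp add: pe_pow_zero)

subsection \<open>The recurrences for power series\<close>

lemma F21_cong: "a = a' \<Longrightarrow> b = b' \<Longrightarrow> c = c' \<Longrightarrow> F21 a b c = F21 a' b' c'"
  "a = b' \<Longrightarrow> b = a' \<Longrightarrow> c = c' \<Longrightarrow> F21 a b c = F21 a' b' c'"
  by (simp_all only: F21_commute)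

lemma pe_pow_plus_nat: "pe_pow (s + of_nat k) = pe_pow s * pe ^ k"
proof (induction k)
  case (Suc k)
  have "pe_pow (s + of_nat (Suc k)) = pe_pow ((s + of_nat k) + 1)" by (simp add: add_ac)
  then show ?case unfolding pe_pow_add[of _ 1] Suc pe_pow_1 by (simp only: power_Suc mult_ac)
qed simp

text \<open>
  Shifting one index turns the pair $(a, b)$ with $b = a + 1/2$ into $(b - 1, a)$ or $(b, a + 1)$, so the
  shifts below also use the symmetry in the upper parameters. The factor \<open>E\<close> carries the exponent of
  the lowest neighbour $(m-1, n-1)$, so that only nonnegative powers of \<open>pe\<close> occur.
\<close>

definition par_a :: "int \<Rightarrow> int \<Rightarrow> complex" where "par_a m n = - 1/24 - of_int m / 2 - of_int n / 2"
definition par_b :: "int \<Rightarrow> int \<Rightarrow> complex" where "par_b m n = 11/24 - of_int m / 2 - of_int n / 2"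
definition par_c :: "int \<Rightarrow> complex" where "par_c m = 3/4 - of_int m"
lemmas par_defs = par_a_def par_b_def par_c_def

lemma par_c_not_Int: "par_c m \<notin> \<int>"
  unfolding par_c_def by (rule c_not_Int)

context
  fixes m n :: int and a b c :: complex and E G D :: "complex fps"
  defines "a \<equiv> par_a m n" and "b \<equiv> par_b m n" and "c \<equiv> par_c m"
    and "E \<equiv> pe_pow (1/12 + of_int m + of_int n - 2)"
    and "G \<equiv> F21 a b c oo Rf" and "D \<equiv> fps_deriv (F21 a b c) oo Rf"
begin

lemma rho_shift:
  "rho m n = E * pe ^ 2 * G"
  "rho m (n + 1) = E * pe ^ 3 * (F21 a (b - 1) c oo Rf)"
  "rho m (n - 1) = E * pe * (F21 (a + 1) b c oo Rf)"
  "rho (m + 1) n = E * pe ^ 3 * (F21 a (b - 1) (c - 1) oo Rf)"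
  "rho (m - 1) n = E * pe * (F21 (a + 1) b (c + 1) oo Rf)"
  "rho (m + 1) (n + 1) = E * pe ^ 4 * (F21 (a - 1) (b - 1) (c - 1) oo Rf)"
  "rho (m - 1) (n - 1) = E * (F21 (a + 1) (b + 1) (c + 1) oo Rf)"
  "rho (m + 1) (n - 1) = E * pe ^ 2 * (F21 a b (c - 1) oo Rf)"
  "rho (m - 1) (n + 1) = E * pe ^ 2 * (F21 a b (c + 1) oo Rf)"
proof -
  note d = a_def b_def c_def par_defs
  have h: "hyp m n = F21 a b c" "hyp (m + 1) (n - 1) = F21 a b (c - 1)" "hyp (m - 1) (n + 1) = F21 a b (c + 1)"
    "hyp (m + 1) (n + 1) = F21 (a - 1) (b - 1) (c - 1)" "hyp (m - 1) (n - 1) = F21 (a + 1) (b + 1) (c + 1)"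
    unfolding hyp_def by (rule F21_cong(1); simp add: d field_simps)+
  have h': "hyp m (n + 1) = F21 a (b - 1) c" "hyp m (n - 1) = F21 (a + 1) b c"
    "hyp (m + 1) n = F21 a (b - 1) (c - 1)" "hyp (m - 1) n = F21 (a + 1) b (c + 1)"
    unfolding hyp_def by (rule F21_cong(2); simp add: d field_simps)+
  \<comment> \<open>The exponent of \<open>E\<close> belongs to index sum m + n - 2, so index sum m
    + n - 2 + k costs k factors of p_e.\<close>
  have p: "pe_pow (1/12 + of_int i + of_int j) = E * pe ^ k" if "i + j + 2 = m + n + int k" for i j k
  proof -
    have "(of_int (i + j + 2) :: complex) = of_int (m + n + int k)" unfolding that ..
    then have "1/12 + of_int i + of_int j = 1/12 + of_int m + of_int n - 2 + (of_nat k :: complex)"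
      by (simp add: algebra_simps)
    then show ?thesis unfolding E_def pe_pow_plus_nat[symmetric] by simp
  qed
  show "rho m n = E * pe ^ 2 * G"
    unfolding rho_def h G_def by (subst p[of _ _ 2]) simp_all
  show "rho m (n + 1) = E * pe ^ 3 * (F21 a (b - 1) c oo Rf)"
    unfolding rho_def h' by (subst p[of _ _ 3]) simp_all
  show "rho m (n - 1) = E * pe * (F21 (a + 1) b c oo Rf)"
    unfolding rho_def h' by (subst p[of _ _ 1]) simp_all
  show "rho (m + 1) n = E * pe ^ 3 * (F21 a (b - 1) (c - 1) oo Rf)"
    unfolding rho_def h' by (subst p[of _ _ 3]) simp_all
  show "rho (m - 1) n = E * pe * (F21 (a + 1) b (c + 1) oo Rf)"
    unfolding rho_def h' by (subst p[of _ _ 1]) simp_all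
  show "rho (m + 1) (n + 1) = E * pe ^ 4 * (F21 (a - 1) (b - 1) (c - 1) oo Rf)"
    unfolding rho_def h by (subst p[of _ _ 4]) simp_all
  show "rho (m - 1) (n - 1) = E * (F21 (a + 1) (b + 1) (c + 1) oo Rf)"
    unfolding rho_def h by (subst p[of _ _ 0]) simp_all
  show "rho (m + 1) (n - 1) = E * pe ^ 2 * (F21 a b (c - 1) oo Rf)"
    unfolding rho_def h by (subst p[of _ _ 2]) simp_all
  show "rho (m - 1) (n + 1) = E * pe ^ 2 * (F21 a b (c + 1) oo Rf)"
    unfolding rho_def h by (subst p[of _ _ 2]) simp_all
qed

text \<open>Origin of the integer coefficients: 12m+12n+1 = -24a, 12m+12n-11 = -24b, 12n-12m+7 =
  24(c-b), 12n-12m+19 = 24(c-a), 4m-3 = -4c, 4m+1 = -4(c-1) and 3n+1 = 3(c-a-b).\<close>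

lemma par_scalars:
  "of_int ((4*m - 3) * (4*m + 1)) = 16 * fps_const c * (fps_const c - 1)"
  "of_int (3 * (12*m - 12*n - 7) * (12*m + 12*n + 1)) = 1728 * fps_const a * (fps_const c - fps_const b)"
  "of_int (12*n - 12*m + 7) = 24 * (fps_const c - fps_const b)"
  "of_int (8 * (3*n + 1)) = 24 * (fps_const c - fps_const a - fps_const b)"
  "of_int (12*n + 12*m + 1) = - 24 * fps_const a"
  "of_int (3 * (4*m - 3) * (4*m + 1)) = 48 * fps_const c * (fps_const c - 1)"
  "of_int (4*m - 3) = - 4 * fps_const c"
  "of_int (12*m + 12*n + 7) = 12 * (1 - fps_const a - fps_const b)"
  "of_int (4 * (3*n + 1)) = 12 * (fps_const c - fps_const a - fps_const b)"
  "of_int (9 * (12*m + 12*n + 1) * (12*m + 12*n - 11)) = 5184 * fps_const a * fps_const b"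
  "of_int (12*m - 12*n - 1) = - 12 * (2 * fps_const c - fps_const a - fps_const b - 1)"
  "of_int (9 * (12*m - 12*n - 7) * (12*m - 12*n - 19)) =
    5184 * (fps_const c - fps_const a) * (fps_const c - fps_const b)"
  unfolding a_def b_def c_def par_defs fps_of_int[symmetric] numeral_fps_const fps_const_1_eq_1[symmetric]
    fps_const_sub fps_const_mult fps_const_neg fps_const_add
  by (simp_all add: field_simps)

lemmas compose_Rf = fps_compose_add_distrib fps_compose_sub_distrib fps_compose_mult_distrib[OF Rf_0]
  fps_const_compose fps_X_fps_compose_startby0[OF Rf_0] fps_compose_1

text \<open>Every neighbour is a combination of the same two series \<open>G\<close> and
  \<open>D\<close>, so any three are linearly dependent. Each recurrence below arises by eliminating
  \<open>D\<close> from two of these lines.\<close>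

lemma compose_contiguous:
  "fps_const a * (F21 (a + 1) b c oo Rf) = Rf * D + fps_const a * G"
  "(fps_const c - fps_const b) * (F21 a (b - 1) c oo Rf) =
    Rf * (1 - Rf) * D + (fps_const c - fps_const b - fps_const a * Rf) * G"
  "(fps_const c - 1) * (F21 a b (c - 1) oo Rf) = Rf * D + (fps_const c - 1) * G"
  "(fps_const c - fps_const a) * (fps_const c - fps_const b) * (F21 a b (c + 1) oo Rf) =
    fps_const c * ((1 - Rf) * D + (fps_const c - fps_const a - fps_const b) * G)"
  "(fps_const c - 1) * (F21 a (b - 1) (c - 1) oo Rf) =
    Rf * (1 - Rf) * D + (fps_const c - 1 - fps_const a * Rf) * G"
  "fps_const a * (fps_const c - fps_const b) * (F21 (a + 1) b (c + 1) oo Rf) =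
    fps_const c * (fps_const a * G - (1 - Rf) * D)"
  "(fps_const c - 1) * (F21 (a - 1) (b - 1) (c - 1) oo Rf) =
    Rf * (1 - Rf) * D + (fps_const c - 1 - (fps_const a + fps_const b - 1) * Rf) * G"
  "fps_const a * fps_const b * (F21 (a + 1) (b + 1) (c + 1) oo Rf) = fps_const c * D"
proof -
  have c: "c \<notin> \<int>" unfolding c_def by (rule par_c_not_Int)
  note * = F21_a_plus[of a b c] F21_b_minus[OF c, of b a] F21_c_minus[OF c, of a b] F21_c_plus[OF c, of a b]
    F21_b_minus_c_minus[OF c, of a b] F21_a_plus_c_plus[OF c, of a b] F21_ab_minus_c_minus[OF c, of a b]
    F21_deriv[OF c, of a b, symmetric]
  note ** = *[unfolded fps_const_sub[symmetric] fps_const_add[symmetric] fps_const_mult[symmetric] fps_const_1_eq_1,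
     THEN arg_cong[where f = "\<lambda>f. f oo Rf"], unfolded compose_Rf]
  show "fps_const a * (F21 (a + 1) b c oo Rf) = Rf * D + fps_const a * G"
    unfolding G_def D_def by (rule **)
  show "(fps_const c - fps_const b) * (F21 a (b - 1) c oo Rf) =
    Rf * (1 - Rf) * D + (fps_const c - fps_const b - fps_const a * Rf) * G"
    unfolding G_def D_def by (rule **)
  show "(fps_const c - 1) * (F21 a b (c - 1) oo Rf) = Rf * D + (fps_const c - 1) * G"
    unfolding G_def D_def by (rule **)
  show "(fps_const c - fps_const a) * (fps_const c - fps_const b) * (F21 a b (c + 1) oo Rf) =
    fps_const c * ((1 - Rf) * D + (fps_const c - fps_const a - fps_const b) * G)"
    unfolding G_def D_def by (rule **)
  show "(fps_const c - 1) * (F21 a (b - 1) (c - 1) oo Rf) =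
    Rf * (1 - Rf) * D + (fps_const c - 1 - fps_const a * Rf) * G"
    unfolding G_def D_def by (rule **)
  show "fps_const a * (fps_const c - fps_const b) * (F21 (a + 1) b (c + 1) oo Rf) =
    fps_const c * (fps_const a * G - (1 - Rf) * D)"
    unfolding G_def D_def by (rule **)
  show "(fps_const c - 1) * (F21 (a - 1) (b - 1) (c - 1) oo Rf) =
    Rf * (1 - Rf) * D + (fps_const c - 1 - (fps_const a + fps_const b - 1) * Rf) * G"
    unfolding G_def D_def by (rule **)
  show "fps_const a * fps_const b * (F21 (a + 1) (b + 1) (c + 1) oo Rf) = fps_const c * D"
    unfolding G_def D_def by (rule **)
qed

text \<open>(c-1) \<open>G1\<close> and a(c-b) \<open>G2\<close> contain \<open>D\<close> with
  coefficients R(1-R) and -c(1-R); the weights c and R eliminate it. The factor 1728 = 16 * 108 is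
  absorbed by R p_e^2 = -108 p_v.\<close>

lemma rho_recurrence_m:
  "of_int ((4*m - 3) * (4*m + 1)) * rho (m+1) n - of_int ((4*m - 3) * (4*m + 1)) * pe * rho m n
   - of_int (3 * (12*m - 12*n - 7) * (12*m + 12*n + 1)) * pv * rho (m-1) n = 0" (is "?L = 0")
proof -
  define A B C where "A = fps_const a" "B = fps_const b" "C = fps_const c"
  define G1 G2 where "G1 = F21 a (b - 1) (c - 1) oo Rf" and "G2 = F21 (a + 1) b (c + 1) oo Rf"
  have "C * (C - 1) * (G1 - G) + A * (C - B) * Rf * G2 = 0"
    using compose_contiguous(5,6) unfolding A_B_C_def[symmetric] G1_def[symmetric] G2_def[symmetric] by algebra
  moreover have "?L = 16 * E * pe ^ 3 * (C * (C - 1) * (G1 - G)) + 16 * E * pe * A * (C - B) * G2 * (- 108 * pv)"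
    unfolding par_scalars rho_shift A_B_C_def[symmetric] G1_def[symmetric] G2_def[symmetric] by algebra
  ultimately show ?thesis using Rf_pe by algebra
qed

text \<open>\<open>D\<close> has coefficient R(1-R) in (c-b) \<open>G1\<close> and R in a
  \<open>G2\<close>; the weight 1-R on the latter becomes p_f^3.\<close>

lemma rho_recurrence_n:
  "of_int (12*n - 12*m + 7) * rho m (n+1) - of_int (8 * (3*n + 1)) * pe * rho m n
    + of_int (12*n + 12*m + 1) * pf ^ 3 * rho m (n-1) = 0" (is "?L = 0")
proof -
  define A B C where "A = fps_const a" "B = fps_const b" "C = fps_const c"
  define G1 G2 where "G1 = F21 a (b - 1) c oo Rf" and "G2 = F21 (a + 1) b c oo Rf"
  have "(C - B) * G1 - (C - A - B) * G - (1 - Rf) * (A * G2) = 0"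
    using compose_contiguous(1,2) unfolding A_B_C_def[symmetric] G1_def[symmetric] G2_def[symmetric] by algebra
  moreover have "?L = 24 * E * pe ^ 3 * ((C - B) * G1 - (C - A - B) * G - (1 - Rf) * (A * G2))"
    unfolding par_scalars rho_shift A_B_C_def[symmetric] G1_def[symmetric] G2_def[symmetric] Rf_pe'[symmetric] by algebra
  ultimately show ?thesis by simp
qed

text \<open>Here ab \<open>G2\<close> is just c \<open>D\<close>, so its weight is the full R(1-R),
  which produces the product p_v p_f^3.\<close>

lemma rho_recurrence_diagonal:
  "of_int (3 * (4*m - 3) * (4*m + 1)) * rho (m+1) (n+1)
    - of_int (4*m - 3) * (of_int (12*m + 12*n + 7) * pf ^ 3 - of_int (4 * (3*n + 1)) * pe ^ 2) * rho m n
    + of_int (9 * (12*m + 12*n + 1) * (12*m + 12*n - 11)) * pv * pf ^ 3 * rho (m-1) (n-1) = 0" (is "?L = 0")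
proof -
  define A B C where "A = fps_const a" "B = fps_const b" "C = fps_const c"
  define G1 G2 where "G1 = F21 (a - 1) (b - 1) (c - 1) oo Rf" and "G2 = F21 (a + 1) (b + 1) (c + 1) oo Rf"
  have "C * ((C - 1) * G1) + C * ((1 - A - B) * (1 - Rf) - (C - A - B)) * G - Rf * (1 - Rf) * (A * B * G2) = 0"
    using compose_contiguous(7,8) unfolding A_B_C_def[symmetric] G1_def[symmetric] G2_def[symmetric] by algebra
  moreover have "?L = 48 * E * pe ^ 4 * (C * ((C - 1) * G1) + C * ((1 - A - B) * (1 - Rf) - (C - A - B)) * G)
      + 48 * A * B * (108 * pv) * ((1 - Rf) * pe ^ 2) * E * G2"
    unfolding par_scalars rho_shift A_B_C_def[symmetric] G1_def[symmetric] G2_def[symmetric] Rf_pe'[symmetric] by algebra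
  moreover have "108 * pv = - (Rf * pe ^ 2)" using Rf_pe by simp
  ultimately show ?thesis by algebra
qed

text \<open>\<open>D\<close> has coefficient R in (c-1) \<open>G1\<close> and c(1-R) in (c-a)(c-b)
  \<open>G2\<close>, so the weights are c(1-R) and R: p_f^3 goes to one neighbour and p_v to the
  other.\<close>

lemma rho_recurrence_antidiagonal:
  "of_int (3 * (4*m - 3) * (4*m + 1)) * pf ^ 3 * rho (m+1) (n-1)
    - of_int (4*m - 3) * (of_int (12*m - 12*n - 1) * pf ^ 3 + of_int (4 * (3*n + 1)) * pe ^ 2) * rho m n
    + of_int (9 * (12*m - 12*n - 7) * (12*m - 12*n - 19)) * pv * rho (m-1) (n+1) = 0" (is "?L = 0")
proof -
  define A B C where "A = fps_const a" "B = fps_const b" "C = fps_const c"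
  define G1 G2 where "G1 = F21 a b (c - 1) oo Rf" and "G2 = F21 a b (c + 1) oo Rf"
  have "C * (1 - Rf) * ((C - 1) * G1) + C * ((C - A - B) - (2 * C - A - B - 1) * (1 - Rf)) * G - Rf * ((C - A) * (C - B) * G2) = 0"
    using compose_contiguous(3,4) unfolding A_B_C_def[symmetric] G1_def[symmetric] G2_def[symmetric] by algebra
  moreover have "?L = 48 * E * pe ^ 4 * (C * (1 - Rf) * ((C - 1) * G1) + C * ((C - A - B) - (2 * C - A - B - 1) * (1 - Rf)) * G)
      + 48 * (C - A) * (C - B) * (108 * pv) * pe ^ 2 * E * G2"
    unfolding par_scalars rho_shift A_B_C_def[symmetric] G1_def[symmetric] G2_def[symmetric] Rf_pe'[symmetric] by algebra
  moreover have "108 * pv = - (Rf * pe ^ 2)" using Rf_pe by simp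
  ultimately show ?thesis by algebra
qed

end

subsection \<open>Rationality of the octahedral functions\<close>

definition rational_fps :: "complex fps \<Rightarrow> bool" where
  "rational_fps X \<longleftrightarrow> (\<exists>f. expansion_of X f)"

lemma rational_fps_poly: "rational_fps (fps_of_poly p)"
  unfolding rational_fps_def using expansion_of_poly by blast

lemma rational_fps_const: "rational_fps (fps_const k)"
  using rational_fps_poly[of "[:k:]"] by (simp add: fps_of_poly_const)

lemma rational_fps_add: "rational_fps X \<Longrightarrow> rational_fps Y \<Longrightarrow> rational_fps (X + Y)"
  unfolding rational_fps_def using expansion_of_add by blast

lemma rational_fps_diff: "rational_fps X \<Longrightarrow> rational_fps Y \<Longrightarrow> rational_fps (X - Y)"
  unfolding rational_fps_def using expansion_of_diff by blast

lemma rational_fps_mult: "rational_fps X \<Longrightarrow> rational_fps Y \<Longrightarrow> rational_fps (X * Y)"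
  unfolding rational_fps_def using expansion_of_mult by blast

lemma rational_fps_power: "rational_fps X \<Longrightarrow> rational_fps (X ^ k)"
  unfolding rational_fps_def using expansion_of_power by blast

lemma rational_fps_deriv: "rational_fps X \<Longrightarrow> rational_fps (fps_deriv X)"
  unfolding rational_fps_def using expansion_of_deriv by blast

lemma rational_fps_cancel: "rational_fps (X * fps_of_poly S) \<Longrightarrow> poly S 0 \<noteq> 0 \<Longrightarrow> rational_fps X"
  unfolding rational_fps_def using expansion_of_cancel by blast

lemma rational_fps_cancel_const: "rational_fps (X * fps_const k) \<Longrightarrow> k \<noteq> 0 \<Longrightarrow> rational_fps X"
  using rational_fps_cancel[of X "[:k:]"] by (simp add: fps_of_poly_const)

lemma rational_fps_one: "rational_fps 1"
  using rational_fps_const[of 1] by simp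

lemma rational_fps_numeral: "rational_fps (numeral k)"
  using rational_fps_const[of "numeral k"] by (simp add: numeral_fps_const)

lemmas rational_fps_intros = rational_fps_poly rational_fps_const rational_fps_add rational_fps_diff
  rational_fps_mult rational_fps_power rational_fps_deriv rational_fps_one rational_fps_numeral

lemma poly_p_e_0: "poly p_e 0 = 1" by (simp add: p_e_def)

lemma rational_fps_Rf: "rational_fps Rf"
proof (rule rational_fps_cancel)
  have "Rf * fps_of_poly (p_e ^ 2) = fps_const (- 108) * pv"
    unfolding fps_of_poly_power Rf_pe by (simp add: numeral_fps_const)
  then show "rational_fps (Rf * fps_of_poly (p_e ^ 2))"
    by (simp only:) (intro rational_fps_intros)
qed (simp add: poly_p_e_0)

text \<open>Once \<open>S * G\<close> is rational, its derivative makes \<open>S * D\<close>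
  rational, and every neighbour is a combination of these two with rational coefficients, up to a
  nonzero constant and a power of p_e.\<close>

lemma
  assumes "rational_fps (rho m n)"
  shows rational_rho_n_minus: "rational_fps (rho m (n - 1))"
    and rational_rho_n_plus: "rational_fps (rho m (n + 1))"
    and rational_rho_antidiagonal: "rational_fps (rho (m + 1) (n - 1))"
    and rational_rho_diagonal: "rational_fps (rho (m - 1) (n - 1))"
proof -
  define a b c where "a = par_a m n" "b = par_b m n" "c = par_c m"
  define E where "E = pe_pow (1/12 + of_int m + of_int n - 2)"
  define G where "G = F21 a b c oo Rf"
  define D where "D = fps_deriv (F21 a b c) oo Rf"
  note defs = a_b_c_def E_def G_def D_def
  define S where "S = E * pe ^ 2"
  define s :: complex where "s = 1/12 + of_int m + of_int n"
  note rho = rho_shift[of m n, folded a_b_c_def E_def, folded G_def D_def]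
  note contig = compose_contiguous[of m n, folded a_b_c_def E_def, folded G_def D_def]
  have c: "c \<notin> \<int>" unfolding defs by (rule par_c_not_Int)
  have nz: "a \<noteq> 0" "b \<noteq> 0" "c - b \<noteq> 0"
  proof -
    have *: "of_int k \<noteq> (0 :: complex)" if "k \<noteq> 0" for k using that by simp
    have "- 24 * a = of_int (12*m + 12*n + 1)" "- 24 * b = of_int (12*m + 12*n - 11)"
      "24 * (c - b) = of_int (12*n - 12*m + 7)"
      unfolding defs par_defs by (simp_all add: field_simps)
    \<comment> \<open>Modulo 12 these integers are 1, 1 and 7, so none of the divisors a, b, c - b
      vanishes.\<close>
    moreover have "12*m + 12*n + 1 \<noteq> 0" "12*m + 12*n - 11 \<noteq> 0" "12*n - 12*m + 7 \<noteq> 0" by presburger+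
    ultimately show "a \<noteq> 0" "b \<noteq> 0" "c - b \<noteq> 0" using * by (metis mult_zero_right)+
  qed
  have S: "S = pe_pow s" unfolding S_def defs s_def pe_pow_plus_nat[symmetric] by (simp add: add.assoc)
  have r: "rho m n = S * G" unfolding rho S_def ..
  have R: "rational_fps (S * G)" using assms unfolding r .
  have SD: "rational_fps (S * D)"
  proof (rule rational_fps_cancel)
    have 1: "pe ^ 3 * fps_deriv G = - 108 * (1 - x) ^ 3 * pf ^ 2 * D"
      unfolding G_def D_def by (rule compose_Rf_deriv)
    have 2: "pe * fps_deriv S = fps_const s * fps_deriv pe * S"
      unfolding S by (rule pe_pow_deriv)
    \<comment> \<open>Subtracting the contribution of S' isolates \<open>S * D\<close> times the
      numerator of R', a polynomial with value -108 at u = 0.\<close>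
    have "pe ^ 3 * fps_deriv (S * G) - fps_const s * fps_deriv pe * pe ^ 2 * (S * G)
      = S * (pe ^ 3 * fps_deriv G) + pe ^ 2 * G * (pe * fps_deriv S - fps_const s * fps_deriv pe * S)"
      unfolding fps_deriv_mult by algebra
    also have "\<dots> = (S * D) * (- 108 * (1 - x) ^ 3 * pf ^ 2)"
      unfolding 1 2 by algebra
    finally have "(S * D) * (- 108 * (1 - x) ^ 3 * pf ^ 2)
      = pe ^ 3 * fps_deriv (S * G) - fps_const s * fps_deriv pe * pe ^ 2 * (S * G)" ..
    moreover have "fps_of_poly ([:-108:] * [:1, -1:] ^ 3 * p_f ^ 2) = - 108 * (1 - x) ^ 3 * pf ^ 2"
      unfolding fps_of_poly_mult fps_of_poly_power by (simp add: fps_of_poly_pCons numeral_fps_const)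
    ultimately show "rational_fps ((S * D) * fps_of_poly ([:-108:] * [:1, -1:] ^ 3 * p_f ^ 2))"
      by (simp only:) (intro rational_fps_intros R)
  qed (simp add: p_f_def)
  show "rational_fps (rho m (n - 1))"
  proof (rule rational_fps_cancel_const[OF rational_fps_cancel])
    have "rho m (n - 1) * fps_const a * pe = S * (fps_const a * (F21 (a + 1) b c oo Rf))"
      unfolding rho S_def by algebra
    also have "\<dots> = Rf * (S * D) + fps_const a * (S * G)"
      unfolding contig by algebra
    finally show "rational_fps (rho m (n - 1) * fps_const a * pe)"
      by (simp only:) (intro rational_fps_intros R SD rational_fps_Rf)
  qed (simp_all add: nz poly_p_e_0)
  show "rational_fps (rho m (n + 1))"
  proof (rule rational_fps_cancel_const)
    have "rho m (n + 1) * fps_const (c - b) = pe * (S * ((fps_const c - fps_const b) * (F21 a (b - 1) c oo Rf)))"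
      unfolding rho S_def fps_const_sub[symmetric] by algebra
    also have "\<dots> = pe * (Rf * (1 - Rf) * (S * D) + (fps_const c - fps_const b - fps_const a * Rf) * (S * G))"
      unfolding contig by algebra
    finally show "rational_fps (rho m (n + 1) * fps_const (c - b))"
      by (simp only:) (intro rational_fps_intros R SD rational_fps_Rf)
  qed (rule nz)
  show "rational_fps (rho (m + 1) (n - 1))"
  proof (rule rational_fps_cancel_const)
    have "rho (m + 1) (n - 1) * fps_const (c - 1) = S * ((fps_const c - 1) * (F21 a b (c - 1) oo Rf))"
      unfolding rho S_def fps_const_sub[symmetric] fps_const_1_eq_1 by algebra
    also have "\<dots> = Rf * (S * D) + (fps_const c - 1) * (S * G)"
      unfolding contig by algebra
    finally show "rational_fps (rho (m + 1) (n - 1) * fps_const (c - 1))"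
      by (simp only:) (intro rational_fps_intros R SD rational_fps_Rf)
  qed (use not_Ints_shift(2)[OF c] in simp)
  show "rational_fps (rho (m - 1) (n - 1))"
  proof (rule rational_fps_cancel_const[OF rational_fps_cancel])
    have "rho (m - 1) (n - 1) * fps_const (a * b) * fps_of_poly (p_e ^ 2)
      = S * (fps_const a * fps_const b * (F21 (a + 1) (b + 1) (c + 1) oo Rf))"
      unfolding rho S_def fps_const_mult[symmetric] fps_of_poly_power by algebra
    also have "\<dots> = fps_const c * (S * D)"
      unfolding contig by algebra
    finally show "rational_fps (rho (m - 1) (n - 1) * fps_const (a * b) * fps_of_poly (p_e ^ 2))"
      by (simp only:) (intro rational_fps_intros R SD rational_fps_Rf)
  qed (simp_all add: nz poly_p_e_0)
qed

text \<open>Steps in n fill the row m = 0. A complete row then yields both adjacent rows, each entry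
  being reached from the position n + 1 by an antidiagonal or a diagonal move.\<close>

lemma rational_rho: "rational_fps (rho m n)"
proof -
  have "\<forall>n. rational_fps (rho m n)"
  proof (induction m rule: int_induct[where k = 0])
    case base
    have "rational_fps (rho 0 n)" for n
    proof (induction n rule: int_induct[where k = 0])
      case base
      show ?case unfolding rho_0_0 by (rule rational_fps_one)
    qed (auto intro: rational_rho_n_plus rational_rho_n_minus)
    then show ?case ..
  next
    case (step1 i)
    have "rational_fps (rho (i + 1) ((n + 1) - 1))" for n
      by (rule rational_rho_antidiagonal) (use step1 in blast)
    then show ?case by simp
  next
    case (step2 i)
    have "rational_fps (rho (i - 1) ((n + 1) - 1))" for n
      by (rule rational_rho_diagonal) (use step2 in blast)
    then show ?case by simp
  qed
  then show ?thesis ..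
qed

lemma expansion_of_oct_r: "expansion_of (rho m n) (oct_r m n)"
  using rational_rho[of m n] oct_r_eqI unfolding rational_fps_def by blast

lemma expansion_of_eq_0: "expansion_of X f \<Longrightarrow> X = 0 \<Longrightarrow> f = 0"
  using expansion_of_zero by simp

lemmas expansion_of_intros = expansion_of_oct_r expansion_of_add expansion_of_diff expansion_of_mult
  expansion_of_power expansion_of_of_int expansion_of_poly

theorem theorem3p3:
  fixes m n :: int
  shows
    "of_int ((4*m - 3) * (4*m + 1)) * oct_r (m+1) n
       - of_int ((4*m - 3) * (4*m + 1)) * to_fract p_e * oct_r m n
       - of_int (3 * (12*m - 12*n - 7) * (12*m + 12*n + 1)) * to_fract p_v * oct_r (m-1) n = 0
     \<and> of_int (12*n - 12*m + 7) * oct_r m (n+1)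
       - of_int (8 * (3*n + 1)) * to_fract p_e * oct_r m n
       + of_int (12*n + 12*m + 1) * to_fract p_f ^ 3 * oct_r m (n-1) = 0
     \<and> of_int (3 * (4*m - 3) * (4*m + 1)) * oct_r (m+1) (n+1)
       - of_int (4*m - 3)
           * (of_int (12*m + 12*n + 7) * to_fract p_f ^ 3 - of_int (4 * (3*n + 1)) * to_fract p_e ^ 2)
           * oct_r m n
       + of_int (9 * (12*m + 12*n + 1) * (12*m + 12*n - 11))
           * to_fract p_v * to_fract p_f ^ 3 * oct_r (m-1) (n-1) = 0
     \<and> of_int (3 * (4*m - 3) * (4*m + 1)) * to_fract p_f ^ 3 * oct_r (m+1) (n-1)
       - of_int (4*m - 3)
           * (of_int (12*m - 12*n - 1) * to_fract p_f ^ 3 + of_int (4 * (3*n + 1)) * to_fract p_e ^ 2)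
           * oct_r m n
       + of_int (9 * (12*m - 12*n - 7) * (12*m - 12*n - 19))
           * to_fract p_v * oct_r (m-1) (n+1) = 0"
  \<comment> \<open>Each left-hand side is the rational function whose expansion is the
    corresponding combination of the \<open>rho\<close> series; that series is 0, and only the zero
    function expands to 0.\<close>
  by (intro conjI
    expansion_of_eq_0[OF _ rho_recurrence_m[where m = m and n = n]] expansion_of_eq_0[OF _ rho_recurrence_n[where m = m and n = n]]
    expansion_of_eq_0[OF _ rho_recurrence_diagonal[where m = m and n = n]] expansion_of_eq_0[OF _ rho_recurrence_antidiagonal[where m = m and n = n]];
    intro expansion_of_intros)

end
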